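(* Let $\Phi$ be a monotone $(\gamma,\lambda)$-concave functional on Borel sets of $\mathbb R^n$ (respectively, on $\mathcal K^n$), with parameters $\gamma\in[-\infty,1]$ and $\lambda\in(0,1)$. Let $\alpha\in[-\gamma,+\infty]$, and let $f,g,h:\mathbb R^n\to[0,+\infty)$ be Borel measurable (respectively, semi-continuous quasi-concave) functions. If $$h((1-\lambda)x+\lambda y)\ge M_\alpha^{(\lambda)}(f(x),g(y))\qquad\text{for all }x,y\in\mathbb R^n\text{ such that }f(x)g(y)>0,$$ then $$\Phi(h)\ge M_\beta^{(\lambda)}(\Phi(f),\Phi(g)),\qquad\text{where }\beta:=\frac{\alpha\gamma}{\alpha+\gamma}.$$ In the extreme cases $\alpha=-\gamma$ and $\alpha=+\infty$, $\beta$ is understood respectively as $\beta=-\infty$ and $\beta=\gamma$; in addition, $\beta=-\infty$ in case $\gamma=-\infty$.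
   Context: Means: for $\lambda\in(0,1)$ and $u,v>0$, $M_\alpha^{(\lambda)}(u,v)=((1-\lambda)u^\alpha+\lambda v^\alpha)^{1/\alpha}$ for finite $\alpha\ne0$ and $M_0^{(\lambda)}(u,v)=u^{1-\lambda}v^\lambda$. For $\alpha\ge0$ the same formulas are used when $u$ or $v$ is zero; for $\alpha<0$ and $uv=0$ the value is $0$. Moreover $M_{-\infty}^{(\lambda)}(u,v)=\min(u,v)$ and $M_{+\infty}^{(\lambda)}(u,v)=\max(u,v)$. If $u=+\infty$ or $v=+\infty$, the value is defined so that monotonicity in each variable is preserved (in particular it is $+\infty$ if $\alpha>0$), and $M_\alpha^{(\lambda)}(+\infty,0)=M_\alpha^{(\lambda)}(0,+\infty)=0$ for $\alpha\le0$. $\mathcal K^n$ is the class of non-empty compact convex subsets of $\mathbb R^n$. $\Phi$ takes values in $[0,+\infty]$ and it is always assumed that $\Phi(\emptyset)=0$. $\Phi$ is monotone if $\Phi(K_0)\le\Phi(K_1)$ whenever $K_0\subseteq K_1$. $\Phi$ is $(\gamma,\lambda)$-concave if $$\Phi((1-\lambda)K_0+\lambda K_1)\ge M_\gamma^{(\lambda)}(\Phi(K_0),\Phi(K_1))$$ for all sets $K_0,K_1$ in the class considered such that $\Phi(K_0)>0$ and $\Phi(K_1)>0$. A monotone $\Phi$ is extended to non-negative functions of the class considered by $\Phi(f)=\int_0^{+\infty}\Phi(\{f\ge r\})\,dr$. A function $f\ge0$ is quasi-concave if $f((1-\mu)x_0+\mu x_1)\ge\min\{f(x_0),f(x_1)\}$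 for all $x_0,x_1\in\mathbb R^n$ and $\mu\in[0,1]$.
   Formalization: If β>0, Φ(f) and Φ(g) are assumed both positive or both zero (else false: f=h=0, g=1_[0,1], Φ=length); on Borel sets Φ is also defined and monotone on Minkowski combinations; on K^n, Φ of a non-compact superlevel set is the supremum over convex bodies inside it. *)

theory Defs
  imports "HOL-Analysis.Analysis"
begin

section \<open>Means on \<open>[0, \<infinity>]\<close>\<close>

text \<open>The conventions \<open>0\<^sup>a = \<infinity>\<close> and \<open>\<infinity>\<^sup>a = 0\<close> for \<open>a < 0\<close>, and \<open>\<infinity>\<^sup>a = \<infinity>\<close>
  for \<open>a > 0\<close>, make this the continuous extension of the power function to \<open>[0, \<infinity>]\<close>.\<close>

definition epowr :: "ennreal \<Rightarrow> real \<Rightarrow> ennreal" where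
  "epowr u a =
     (if a = 0 then 1
      else if a > 0 then (if u = \<infinity> then \<infinity> else ennreal (enn2real u powr a))
      else (if u = 0 then \<infinity> else if u = \<infinity> then 0 else ennreal (enn2real u powr a)))"

text \<open>With these conventions, and with \<open>0 * \<infinity> = 0\<close> in \<^typ>\<open>ennreal\<close>, the two
  formulas below also give the boundary values of the mean: for \<open>\<alpha> < 0\<close> it is \<open>0\<close> as soon
  as one argument is \<open>0\<close>, for \<open>\<alpha> > 0\<close> it is \<open>\<infinity>\<close> as soon as one argument is \<open>\<infinity>\<close>, for
  \<open>\<alpha> \<le> 0\<close> the value at \<open>(\<infinity>, 0)\<close> and \<open>(0, \<infinity>)\<close> is \<open>0\<close>, and the value at an infinite
  argument is otherwise the limit (the supremum) of the values at finite arguments.\<close>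

definition power_mean :: "ereal \<Rightarrow> real \<Rightarrow> ennreal \<Rightarrow> ennreal \<Rightarrow> ennreal" where
  "power_mean \<alpha> lam u v =
     (case \<alpha> of
        ereal a \<Rightarrow>
          (if a = 0 then epowr u (1 - lam) * epowr v lam
           else epowr (ennreal (1 - lam) * epowr u a + ennreal lam * epowr v a) (1 / a))
      | PInfty \<Rightarrow> max u v
      | MInfty \<Rightarrow> min u v)"

text \<open>The clause \<open>\<alpha> = - \<gamma>\<close> comes first, so that the exponent is \<open>-\<infinity>\<close> also for
  \<open>\<alpha> = \<gamma> = 0\<close> and for \<open>\<gamma> = -\<infinity>\<close>, \<open>\<alpha> = \<infinity>\<close>.\<close>

definition mean_exponent :: "ereal \<Rightarrow> ereal \<Rightarrow> ereal" where
  "mean_exponent \<alpha> \<gamma> =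
     (if \<alpha> = - \<gamma> \<or> \<gamma> = -\<infinity> then -\<infinity>
      else if \<alpha> = \<infinity> then \<gamma>
      else \<alpha> * \<gamma> / (\<alpha> + \<gamma>))"


section \<open>Functionals on classes of sets\<close>

definition minkowski_comb ::
  "real \<Rightarrow> 'a::real_vector set \<Rightarrow> 'a set \<Rightarrow> 'a set" where
  "minkowski_comb lam K0 K1 = {(1 - lam) *\<^sub>R x + lam *\<^sub>R y | x y. x \<in> K0 \<and> y \<in> K1}"

definition convex_bodies :: "'a::euclidean_space set set" where
  "convex_bodies = {K. K \<noteq> {} \<and> compact K \<and> convex K}"

text \<open>The combination of two Borel sets need not be Borel. For the concavity inequality to
  make sense, a functional on Borel sets therefore has to be defined, and monotone, on these
  combinations as well; on no other set is its value relevant. The class of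
  convex bodies is closed under combinations, so that nothing is added to it.\<close>

definition with_combs :: "real \<Rightarrow> 'a::real_vector set set \<Rightarrow> 'a set set" where
  "with_combs lam \<C> = \<C> \<union> {minkowski_comb lam K0 K1 | K0 K1. K0 \<in> \<C> \<and> K1 \<in> \<C>}"

definition concave_functional ::
  "'a::real_vector set set \<Rightarrow> ereal \<Rightarrow> real \<Rightarrow> ('a set \<Rightarrow> ennreal) \<Rightarrow> bool" where
  "concave_functional \<C> \<gamma> lam \<Phi> \<longleftrightarrow>
     (\<forall>K0\<in>\<C>. \<forall>K1\<in>\<C>. 0 < \<Phi> K0 \<and> 0 < \<Phi> K1 \<longrightarrow>
        power_mean \<gamma> lam (\<Phi> K0) (\<Phi> K1) \<le> \<Phi> (minkowski_comb lam K0 K1))"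


section \<open>Extension to functions\<close>

text \<open>A superlevel set of a Borel function is Borel, and a superlevel set of a
  semicontinuous quasi-concave function is convex, but it can fail to be compact.
  Such a set is given the value obtained by inner approximation with members of the
  class. On the class itself the value is \<open>\<Phi> A\<close>, and
  \<open>\<Phi> \<emptyset> = 0\<close> is respected because the supremum over the empty set is \<open>0\<close>.\<close>

definition value_on ::
  "'a set set \<Rightarrow> ('a set \<Rightarrow> ennreal) \<Rightarrow> 'a set \<Rightarrow> ennreal" where
  "value_on \<C> \<Phi> A = (if A \<in> \<C> then \<Phi> A else (SUP K\<in>{K \<in> \<C>. K \<subseteq> A}. \<Phi> K))"

definition functional_ext ::
  "'a set set \<Rightarrow> ('a set \<Rightarrow> ennreal) \<Rightarrow> ('a \<Rightarrow> real) \<Rightarrow> ennreal" where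
  "functional_ext \<C> \<Phi> f = (\<integral>\<^sup>+ r\<in>{0<..}. value_on \<C> \<Phi> {x. r \<le> f x} \<partial>lborel)"

definition quasi_concave :: "('a::real_vector \<Rightarrow> real) \<Rightarrow> bool" where
  "quasi_concave f \<longleftrightarrow>
     (\<forall>x0 x1. \<forall>\<mu>\<in>{0..1}. min (f x0) (f x1) \<le> f ((1 - \<mu>) *\<^sub>R x0 + \<mu> *\<^sub>R x1))"

definition upper_semicontinuous :: "('a::topological_space \<Rightarrow> real) \<Rightarrow> bool" where
  "upper_semicontinuous f \<longleftrightarrow> (\<forall>c. open {x. f x < c})"

definition lower_semicontinuous :: "('a::topological_space \<Rightarrow> real) \<Rightarrow> bool" where
  "lower_semicontinuous f \<longleftrightarrow> (\<forall>c. open {x. c < f x})"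

definition semicontinuous :: "('a::topological_space \<Rightarrow> real) \<Rightarrow> bool" where
  "semicontinuous f \<longleftrightarrow> upper_semicontinuous f \<or> lower_semicontinuous f"

end

theory Submission
  imports Defs
begin

text \<open>
  Write \<open>\<phi>\<close>, \<open>\<psi>\<close>, \<open>\<chi>\<close> for the non-increasing functions that send a level \<open>r > 0\<close> to the value
  of \<open>\<Phi>\<close> on the superlevel sets at \<open>r\<close> of \<open>f\<close>, \<open>g\<close>, \<open>h\<close>. Monotonicity and concavity of \<open>\<Phi>\<close>, together
  with the hypothesis on \<open>h\<close>, imply that
  \<open>\<chi> (M\<^sub>\<alpha>(r, s)) \<ge> M\<^sub>\<gamma>(\<phi> r, \<psi> s)\<close> whenever \<open>\<phi> r, \<psi> s > 0\<close>. The space \<open>\<real>\<^sup>n\<close> is then no longer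
  needed. In terms of the regions under the graphs, \<open>P\<close> for \<open>\<phi>\<close>, \<open>Q\<close> for \<open>\<psi>\<close> and \<open>R\<close> for \<open>\<chi>\<close>, which
  have area \<open>\<Phi>(f)\<close>, \<open>\<Phi>(g)\<close>, \<open>\<Phi>(h)\<close>, the inequality says that \<open>(r, u) \<in> P\<close> and \<open>(s, v) \<in> Q\<close> imply
  \<open>(M\<^sub>\<alpha>(r, s), M\<^sub>\<gamma>(u, v)) \<in> R\<close>. The theorem thus becomes a Brunn--Minkowski inequality in the
  plane, \<open>|R| \<ge> M\<^sub>\<beta>(|P|, |Q|)\<close>, for a sum that is formed with a different mean in each coordinate
  (\<open>planar_brunn_minkowski\<close>).

  If \<open>\<gamma> = -\<infinity>\<close>, then \<open>\<alpha> = \<infinity>\<close>, and \<open>P \<subseteq> R\<close> or \<open>Q \<subseteq> R\<close>, because the projections of \<open>P\<close> and \<open>Q\<close> to the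
  second axis are nested.

  If \<open>\<gamma> = c\<close> is a real number, slice horizontally. The slice of \<open>R\<close> at height \<open>M\<^sub>c(u, v)\<close> has length
  at least \<open>M\<^sub>\<alpha>(a, b)\<close>, where \<open>a\<close> and \<open>b\<close> are the lengths of the slices of \<open>P\<close> at \<open>u\<close> and of \<open>Q\<close> at
  \<open>v\<close>. The substitution \<open>u = (1 + c x)\<^sup>1\<^sup>/\<^sup>c\<close> (or \<open>u = e\<^sup>x\<close>), which has derivative \<open>u\<^sup>1\<^sup>-\<^sup>c\<close>, turns \<open>M\<^sub>c\<close>
  into the arithmetic mean of \<open>x\<close> and \<open>y\<close>. What remains is a one-dimensional inequality of
  Borell--Brascamp--Lieb type (\<open>borell_brascamp_lieb_real\<close>). Its proof compares the
  level sets of the two functions, each taken relative to its own supremum, by means of the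
  inequality \<open>|A + B| \<ge> |A| + |B|\<close> on the line. It reduces the claim to the pointwise estimate
  \<open>M\<^sub>\<alpha>(a, b) M\<^sub>c(u, v)\<^sup>1\<^sup>-\<^sup>c M\<^sub>1(F / (a u\<^sup>1\<^sup>-\<^sup>c), G / (b v\<^sup>1\<^sup>-\<^sup>c)) \<ge> M\<^sub>\<beta>(F, G)\<close>
  (\<open>three_factor_hoelder\<close>), where \<open>\<gamma> \<le> 1\<close> keeps the power \<open>1 - c\<close> non-negative. With vertical slices
  the roles of \<open>\<alpha>\<close> and \<open>\<gamma>\<close> would be interchanged, and \<open>\<alpha>\<close> may exceed \<open>1\<close>.

  The pointwise estimate follows from an entropy formula: the logarithm of a power mean
  with nonzero exponent is an extremum over \<open>p \<in> (0, 1)\<close> of expressions that are linear in the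
  logarithms of the two arguments, up to an entropy term in which the exponent occurs only through
  its reciprocal; and the reciprocals add up, \<open>1/\<alpha> + (1 - c)/c + 1 = 1/\<beta>\<close>.

  The area argument needs bounded regions away from the axis. The general case follows by
  exhaustion, since the means are continuous on \<open>(0, \<infinity>]\<close>.
\<close>

section \<open>Power means\<close>

text \<open>On positive reals the power mean is itself a positive real, so that logarithms can be taken.\<close>
definition real_mean :: "ereal \<Rightarrow> real \<Rightarrow> real \<Rightarrow> real \<Rightarrow> real" where
  "real_mean \<alpha> lam a b =
     (case \<alpha> of
        ereal r \<Rightarrow>
          (if r = 0 then a powr (1 - lam) * b powr lam
           else ((1 - lam) * a powr r + lam * b powr r) powr (1 / r))
      | PInfty \<Rightarrow> max a b
      | MInfty \<Rightarrow> min a b)"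

lemma real_mean_simps:
  "real_mean \<infinity> lam a b = max a b" "real_mean (-\<infinity>) lam a b = min a b"
  "real_mean 0 lam a b = a powr (1 - lam) * b powr lam"
  "r \<noteq> 0 \<Longrightarrow> real_mean (ereal r) lam a b = ((1 - lam) * a powr r + lam * b powr r) powr (1 / r)"
  by (simp_all add: real_mean_def zero_ereal_def)

lemma epowr_ennreal: "0 < a \<Longrightarrow> epowr (ennreal a) r = ennreal (a powr r)"
  by (auto simp: epowr_def)

context
  fixes lam :: real
  assumes lam: "0 < lam" "lam < 1"
begin

lemma wsum_pos: "0 < a \<Longrightarrow> 0 < b \<Longrightarrow> 0 < (1 - lam) * a + lam * b"
  using lam by (simp add: add_pos_pos)

lemma real_mean_pos: "0 < a \<Longrightarrow> 0 < b \<Longrightarrow> 0 < real_mean \<alpha> lam a b"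
  by (cases \<alpha>) (use wsum_pos[of "a powr r" "b powr r" for r] in \<open>auto simp: real_mean_def less_max_iff_disj less_imp_neq[symmetric]\<close>)

lemma power_mean_ennreal:
  assumes "0 < a" "0 < b"
  shows "power_mean \<alpha> lam (ennreal a) (ennreal b) = ennreal (real_mean \<alpha> lam a b)"
proof (cases \<alpha>)
  case (real r)
  show ?thesis
  proof (cases "r = 0")
    case True
    then show ?thesis using assms real
      by (simp add: power_mean_def real_mean_def epowr_ennreal ennreal_mult)
  next
    case False
    have "ennreal (1 - lam) * ennreal (a powr r) + ennreal lam * ennreal (b powr r)
      = ennreal ((1 - lam) * a powr r + lam * b powr r)"
      using lam by (simp add: ennreal_mult ennreal_plus)
    then show ?thesis using False assms real wsum_pos[of "a powr r" "b powr r"]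
      by (simp add: power_mean_def real_mean_def epowr_ennreal)
  qed
qed (use assms in \<open>auto simp: power_mean_def real_mean_def max_def min_def ennreal_le_iff\<close>)

lemma real_mean_scale:
  assumes "0 < a" "0 < b" "0 < k"
  shows "real_mean \<alpha> lam (k * a) (k * b) = k * real_mean \<alpha> lam a b"
proof (cases \<alpha>)
  case (real r)
  show ?thesis
  proof (cases "r = 0")
    case True
    have "k powr (1 - lam) * k powr lam = k" using assms by (simp flip: powr_add)
    then show ?thesis using True assms real by (simp add: real_mean_def powr_mult algebra_simps)
  next
    case False
    have "(1 - lam) * (k * a) powr r + lam * (k * b) powr r = k powr r * ((1 - lam) * a powr r + lam * b powr r)"
      using assms by (simp add: powr_mult algebra_simps)
    then show ?thesis
      using False assms real by (simp add: real_mean_def powr_mult powr_powr)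
  qed
qed (use assms in \<open>auto simp: real_mean_def max_mult_distrib_left min_mult_distrib_left\<close>)

lemma epowr_mono: "0 \<le> r \<Longrightarrow> u \<le> v \<Longrightarrow> epowr u r \<le> epowr v r"
  by (cases u; cases v) (auto simp: epowr_def top_unique intro!: ennreal_leI powr_mono2)

lemma epowr_antimono: "r \<le> 0 \<Longrightarrow> u \<le> v \<Longrightarrow> epowr v r \<le> epowr u r"
  by (cases u; cases v) (auto simp: epowr_def top_unique ennreal_le_iff intro!: ennreal_leI powr_mono2')

lemma power_mean_mono:
  assumes "u \<le> u'" "v \<le> v'"
  shows "power_mean \<alpha> lam u v \<le> power_mean \<alpha> lam u' v'"
proof (cases \<alpha>)
  case (real r)
  consider "r = 0" | "r > 0" | "r < 0" by linarith
  then show ?thesis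
  proof cases
    case 1
    then show ?thesis using real assms lam
      by (auto simp: power_mean_def intro!: mult_mono epowr_mono)
  next
    case 2
    then show ?thesis using real assms
      by (auto simp: power_mean_def intro!: epowr_mono add_mono mult_left_mono)
  next
    case 3
    then show ?thesis using real assms
      by (auto simp: power_mean_def divide_le_0_iff intro!: epowr_antimono add_mono mult_left_mono)
  qed
qed (use assms in \<open>auto simp: power_mean_def le_max_iff_disj min_le_iff_disj\<close>)

section \<open>An entropy formula for power means and a three-factor Hoelder inequality\<close>

definition log_interp :: "real \<Rightarrow> real \<Rightarrow> real \<Rightarrow> real" where
  "log_interp p a b = (1 - p) * ln a + p * ln b"

text \<open>The relative entropy of the distribution \<open>(1 - p, p)\<close> with respect to \<open>(1 - lam, lam)\<close>.\<close>
definition rel_entropy :: "real \<Rightarrow> real" where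
  "rel_entropy p = (1 - p) * ln ((1 - p) / (1 - lam)) + p * ln (p / lam)"

lemma log_interp_mult: "0 < a \<Longrightarrow> 0 < b \<Longrightarrow> 0 < c \<Longrightarrow> 0 < d \<Longrightarrow> log_interp p (a * c) (b * d) = log_interp p a b + log_interp p c d"
  by (simp add: log_interp_def ln_mult algebra_simps)

lemma log_interp_powr: "0 < a \<Longrightarrow> 0 < b \<Longrightarrow> log_interp p (a powr r) (b powr r) = r * log_interp p a b"
  by (simp add: log_interp_def ln_powr algebra_simps)

lemma log_interp_divide: "0 < a \<Longrightarrow> 0 < b \<Longrightarrow> 0 < c \<Longrightarrow> 0 < d \<Longrightarrow> log_interp p (a / c) (b / d) = log_interp p a b - log_interp p c d"
  by (simp add: log_interp_def ln_div algebra_simps)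

lemma rel_entropy_lam: "rel_entropy lam = 0" using lam by (simp add: rel_entropy_def)

text \<open>Jensen's inequality for the logarithm, after the sum has been written as a mean with weights
  \<open>1 - p\<close> and \<open>p\<close>. Equality holds if \<open>p\<close> is the share of the second summand. After division by
  an exponent \<open>r\<close>, this describes the logarithm of a power mean as a supremum over \<open>p\<close> if \<open>r > 0\<close>
  and as an infimum if \<open>r < 0\<close>.\<close>
lemma ln_wsum_ge:
  assumes "0 < a" "0 < b" "0 < p" "p < 1"
  shows "log_interp p a b - rel_entropy p \<le> ln ((1 - lam) * a + lam * b)"
proof -
  have pos: "0 < (1 - lam) * a / (1 - p)" "0 < lam * b / p" using assms lam by auto
  have "(1 - p) * ln ((1 - lam) * a / (1 - p)) + p * ln (lam * b / p)
    \<le> ln ((1 - p) * ((1 - lam) * a / (1 - p)) + p * (lam * b / p))"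
    using concave_onD[OF ln_concave, of p "(1 - lam) * a / (1 - p)" "lam * b / p"] pos assms
    by (simp add: algebra_simps)
  moreover have "(1 - p) * ((1 - lam) * a / (1 - p)) + p * (lam * b / p) = (1 - lam) * a + lam * b"
    using assms by simp
  moreover have "(1 - p) * ln ((1 - lam) * a / (1 - p)) + p * ln (lam * b / p) = log_interp p a b - rel_entropy p"
  proof -
    have "ln ((1 - lam) * a / (1 - p)) = ln a - ln ((1 - p) / (1 - lam))"
      "ln (lam * b / p) = ln b - ln (p / lam)"
      using assms lam by (simp_all add: ln_mult ln_div)
    then show ?thesis by (simp only: log_interp_def rel_entropy_def right_diff_distrib)
  qed
  ultimately show ?thesis by simp
qed

lemma ln_wsum_eq:
  assumes "0 < a" "0 < b"
  shows "\<exists>p. 0 < p \<and> p < 1 \<and> ln ((1 - lam) * a + lam * b) = log_interp p a b - rel_entropy p"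
proof -
  define s where "s = (1 - lam) * a + lam * b"
  define p where "p = lam * b / s"
  have s: "0 < s" unfolding s_def using wsum_pos assms by simp
  have q: "1 - p = (1 - lam) * a / s" using s by (simp add: p_def s_def field_simps)
  have p: "0 < p" "0 < 1 - p" using s lam assms by (simp add: p_def) (use s lam assms in \<open>simp add: q\<close>)
  have "ln p = ln lam + ln b - ln s" unfolding p_def using lam assms s by (simp add: ln_mult ln_div)
  moreover have "ln (1 - p) = ln (1 - lam) + ln a - ln s" unfolding q using lam assms s by (simp add: ln_mult ln_div)
  ultimately have "ln ((1 - p) / (1 - lam)) = ln a - ln s" "ln (p / lam) = ln b - ln s"
    using p lam by (simp_all add: ln_div)
  then have "log_interp p a b - rel_entropy p = (1 - p) * ln s + p * ln s"
    unfolding log_interp_def rel_entropy_def by (simp only: right_diff_distrib)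
  then show ?thesis using p by (intro exI[of _ p]) (simp add: s_def algebra_simps)
qed

lemma ln_real_mean_real:
  assumes "0 < a" "0 < b" "r \<noteq> 0"
  shows "ln (real_mean (ereal r) lam a b) = ln ((1 - lam) * a powr r + lam * b powr r) / r"
  using assms wsum_pos[of "a powr r" "b powr r"] by (simp add: real_mean_simps ln_powr)

lemma ln_real_mean_ge:
  assumes "0 < a" "0 < b" "0 < p" "p < 1" "0 < r"
  shows "log_interp p a b - rel_entropy p / r \<le> ln (real_mean (ereal r) lam a b)"
proof -
  have "(r * log_interp p a b - rel_entropy p) / r \<le> ln ((1 - lam) * a powr r + lam * b powr r) / r"
    using assms ln_wsum_ge[of "a powr r" "b powr r" p] by (intro divide_right_mono) (simp_all add: log_interp_powr)
  then show ?thesis using assms by (simp add: ln_real_mean_real diff_divide_distrib)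
qed

lemma ln_real_mean_le:
  assumes "0 < a" "0 < b" "0 < p" "p < 1" "r < 0"
  shows "ln (real_mean (ereal r) lam a b) \<le> log_interp p a b - rel_entropy p / r"
proof -
  have "ln ((1 - lam) * a powr r + lam * b powr r) / r \<le> (r * log_interp p a b - rel_entropy p) / r"
    using assms ln_wsum_ge[of "a powr r" "b powr r" p] by (intro divide_right_mono_neg) (simp_all add: log_interp_powr)
  then show ?thesis using assms by (simp add: ln_real_mean_real diff_divide_distrib)
qed

lemma ln_real_mean_eq:
  assumes "0 < a" "0 < b" "r \<noteq> 0"
  shows "\<exists>p. 0 < p \<and> p < 1 \<and> ln (real_mean (ereal r) lam a b) = log_interp p a b - rel_entropy p / r"
  using assms ln_wsum_eq[of "a powr r" "b powr r"]
  by (auto simp: ln_real_mean_real log_interp_powr diff_divide_distrib)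

lemma ln_real_mean_zero:
  assumes "0 < a" "0 < b"
  shows "ln (real_mean 0 lam a b) = log_interp lam a b"
  using assms by (simp add: real_mean_simps log_interp_def ln_mult ln_powr)

lemma log_interp_le_ln_max:
  assumes "0 < a" "0 < b" "0 < p" "p < 1"
  shows "log_interp p a b \<le> ln (max a b)"
proof -
  have "log_interp p a b \<le> (1 - p) * ln (max a b) + p * ln (max a b)"
    unfolding log_interp_def using assms by (intro add_mono mult_left_mono) (auto simp: less_max_iff_disj)
  then show ?thesis by (simp add: algebra_simps)
qed

lemma ln_min_le_log_interp:
  assumes "0 < a" "0 < b" "0 < p" "p < 1"
  shows "ln (min a b) \<le> log_interp p a b"
proof -
  have "(1 - p) * ln (min a b) + p * ln (min a b) \<le> log_interp p a b"
    unfolding log_interp_def using assms by (intro add_mono mult_left_mono) auto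
  then show ?thesis by (simp add: algebra_simps)
qed

text \<open>For the maximum the entropy term disappears, which is the case \<open>1 / \<infinity> = 0\<close> of the formula.\<close>
lemma ln_real_mean_ge_ereal:
  assumes "0 < a" "0 < b" "0 < p" "p < 1" "0 < \<alpha>"
  shows "log_interp p a b - rel_entropy p * (if \<alpha> = \<infinity> then 0 else 1 / real_of_ereal \<alpha>) \<le> ln (real_mean \<alpha> lam a b)"
  using assms by (cases \<alpha>) (use ln_real_mean_ge in \<open>auto simp: real_mean_simps log_interp_le_ln_max\<close>)

text \<open>The entropy formula sees an exponent only through its reciprocal, from which the sign of the
  exponent can be read off as well.\<close>
lemma mean_exponent_inverse:
  assumes "- ereal c < \<alpha>" "\<alpha> \<noteq> 0" "c \<noteq> 0"
  shows "\<exists>e. mean_exponent \<alpha> (ereal c) = ereal e \<and> e \<noteq> 0 \<and>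
    1 / e = (if \<alpha> = \<infinity> then 0 else 1 / real_of_ereal \<alpha>) + 1 / c"
proof (cases \<alpha>)
  case (real x)
  have "x * c / (x + c) \<noteq> 0" "1 / (x * c / (x + c)) = 1 / x + 1 / c" "x + c \<noteq> 0" "x \<noteq> - c"
    using assms real by (auto simp: divide_simps)
  then show ?thesis using real by (auto simp: mean_exponent_def)
qed (use assms in \<open>auto simp: mean_exponent_def\<close>)

text \<open>Take logarithms. The bounds of the entropy formula, all at the same \<open>p\<close>, add up:
  the linear terms in \<open>a\<close>, \<open>b\<close>, \<open>u\<close>, \<open>v\<close> cancel, and what is left is the term of the entropy
  formula for \<open>M\<^sub>\<beta>(F, G)\<close> at \<open>p\<close>. A positive exponent gives a lower bound for every \<open>p\<close>. At most
  one of \<open>\<alpha>\<close>, \<open>c\<close> is negative, and for that mean \<open>p\<close> has to be the minimiser; then \<open>\<beta>\<close> is negative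
  or \<open>-\<infinity>\<close>, so that any \<open>p\<close> is good enough for \<open>M\<^sub>\<beta>\<close>. If both exponents are positive, so is \<open>\<beta>\<close>,
  and \<open>p\<close> is the maximiser for \<open>M\<^sub>\<beta>\<close>. If one of them is \<open>0\<close>, the choice \<open>p = lam\<close>, where the entropy
  vanishes, gives the estimate by the weighted geometric mean.\<close>
lemma three_factor_hoelder:
  fixes a b u v F G c :: real
  assumes pos: "0 < a" "0 < b" "0 < u" "0 < v" "0 < F" "0 < G"
    and c: "c \<le> 1" and \<alpha>: "- ereal c \<le> \<alpha>"
  shows "real_mean (mean_exponent \<alpha> (ereal c)) lam F G
    \<le> real_mean \<alpha> lam a b * real_mean (ereal c) lam u v powr (1 - c)
       * ((1 - lam) * (F / (a * u powr (1 - c))) + lam * (G / (b * v powr (1 - c))))"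
proof -
  define \<beta> where "\<beta> = mean_exponent \<alpha> (ereal c)"
  define W where "W = (1 - lam) * (F / (a * u powr (1 - c))) + lam * (G / (b * v powr (1 - c)))"
  have W0: "0 < W" unfolding W_def using pos by (intro wsum_pos) auto
  have W: "log_interp p F G - log_interp p a b - (1 - c) * log_interp p u v - rel_entropy p \<le> ln W" if "0 < p" "p < 1" for p
    unfolding W_def
    using ln_wsum_ge[of "F / (a * u powr (1 - c))" "G / (b * v powr (1 - c))" p] pos that
    by (simp add: log_interp_divide log_interp_mult log_interp_powr)
  define j where "j = (if \<alpha> = \<infinity> then 0 else 1 / real_of_ereal \<alpha>)"
  have alpha_cases: "\<alpha> = \<infinity> \<or> (\<exists>x. \<alpha> = ereal x \<and> - c \<le> x)"
    using \<alpha> by (cases \<alpha>) auto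
  have scaled: "(1 - c) * x \<le> (1 - c) * y" if "x \<le> y" for x y
    using c that by (intro mult_left_mono) auto
  have "ln (real_mean \<beta> lam F G) \<le> ln (real_mean \<alpha> lam a b) + (1 - c) * ln (real_mean (ereal c) lam u v) + ln W"
  proof -
    \<comment> \<open>The extremal \<open>p\<close> is prescribed by \<open>M\<^sub>\<beta>\<close> in the first case, by \<open>M\<^sub>c\<close> in the second,
      by \<open>M\<^sub>\<alpha>\<close> in the third; in the last it is \<open>lam\<close>.\<close>
    consider (pp) "0 < \<alpha>" "0 < c" | (pn) "c < 0" | (np) "\<alpha> < 0" | (z) "\<alpha> = 0 \<and> 0 \<le> c \<or> c = 0 \<and> 0 < \<alpha>"
      using \<alpha> by (cases \<alpha>) force+
    then show ?thesis
    proof cases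
      case pp
      obtain e where e: "\<beta> = ereal e" "0 < e" "1 / e = j + 1 / c"
      proof -
        have "0 < j + 1 / c" using pp by (cases \<alpha>) (auto simp: j_def add_pos_pos add_nonneg_pos)
        moreover have "- ereal c < \<alpha>" using pp by (cases \<alpha>) auto
        ultimately show ?thesis using mean_exponent_inverse[of c \<alpha>] pp that
          unfolding \<beta>_def j_def[symmetric] by (metis less_irrefl zero_less_divide_1_iff)
      qed
      obtain p where p: "0 < p" "p < 1" "ln (real_mean \<beta> lam F G) = log_interp p F G - rel_entropy p / e"
        using ln_real_mean_eq[of F G e] e pos by auto
      have "rel_entropy p / e = rel_entropy p * j + rel_entropy p / c" using e(3) by (metis distrib_left times_divide_eq_right mult.right_neutral)
      moreover have "log_interp p a b - rel_entropy p * j \<le> ln (real_mean \<alpha> lam a b)"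
        unfolding j_def using ln_real_mean_ge_ereal pos p pp by blast
      moreover have "(1 - c) * (log_interp p u v - rel_entropy p / c) \<le> (1 - c) * ln (real_mean (ereal c) lam u v)"
        using ln_real_mean_ge pos p pp by (intro scaled) blast
      moreover have "(1 - c) * (log_interp p u v - rel_entropy p / c) = (1 - c) * log_interp p u v - rel_entropy p / c + rel_entropy p"
        using pp by (simp add: field_simps)
      ultimately show ?thesis using W[OF p(1,2)] p(3) by linarith
    next
      case pn
      have a0: "0 < \<alpha>" using pn \<alpha> by (cases \<alpha>) auto
      obtain p where p: "0 < p" "p < 1" "ln (real_mean (ereal c) lam u v) = log_interp p u v - rel_entropy p / c"
        using ln_real_mean_eq[of u v c] pn pos by auto
      have "(1 - c) * ln (real_mean (ereal c) lam u v) = (1 - c) * log_interp p u v - rel_entropy p / c + rel_entropy p"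
        using pn by (simp add: p field_simps)
      moreover have "log_interp p a b - rel_entropy p * j \<le> ln (real_mean \<alpha> lam a b)"
        unfolding j_def using ln_real_mean_ge_ereal pos p a0 by blast
      moreover have "ln (real_mean \<beta> lam F G) \<le> log_interp p F G - rel_entropy p * j - rel_entropy p / c"
      proof (cases "\<alpha> = - ereal c")
        case True
        then have "\<beta> = -\<infinity>" "j = - (1 / c)" using pn by (simp_all add: \<beta>_def mean_exponent_def j_def)
        then show ?thesis using ln_min_le_log_interp[of F G p] pos p by (simp add: real_mean_simps)
      next
        case False
        obtain e where e: "\<beta> = ereal e" "e < 0" "1 / e = j + 1 / c"
        proof -
          have gt: "- ereal c < \<alpha>" using False \<alpha> by simp
          then have "j + 1 / c < 0" using pn a0
            by (cases \<alpha>) (auto simp: j_def divide_simps zero_less_mult_iff mult_less_0_iff)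
          then show ?thesis using mean_exponent_inverse[OF gt] a0 pn that
            unfolding \<beta>_def j_def[symmetric] by (metis less_irrefl divide_less_0_1_iff)
        qed
        have "rel_entropy p / e = rel_entropy p * j + rel_entropy p / c" using e(3) by (metis distrib_left times_divide_eq_right mult.right_neutral)
        then show ?thesis using ln_real_mean_le[of F G p e] pos p e by simp
      qed
      ultimately show ?thesis using W[OF p(1,2)] by linarith
    next
      case np
      then obtain x where x: "\<alpha> = ereal x" "- c \<le> x" "x < 0" using alpha_cases by auto
      then have c0: "0 < c" by simp
      have j: "j = 1 / x" using x by (simp add: j_def)
      obtain p where p: "0 < p" "p < 1" "ln (real_mean \<alpha> lam a b) = log_interp p a b - rel_entropy p / x"
        using ln_real_mean_eq[of a b x] x pos by auto
      have "(1 - c) * (log_interp p u v - rel_entropy p / c) \<le> (1 - c) * ln (real_mean (ereal c) lam u v)"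
        using ln_real_mean_ge pos p c0 by (intro scaled) blast
      moreover have "(1 - c) * (log_interp p u v - rel_entropy p / c) = (1 - c) * log_interp p u v - rel_entropy p / c + rel_entropy p"
        using c0 by (simp add: field_simps)
      moreover have "ln (real_mean \<beta> lam F G) \<le> log_interp p F G - rel_entropy p / x - rel_entropy p / c"
      proof (cases "\<alpha> = - ereal c")
        case True
        then have "\<beta> = -\<infinity>" "x = - c" using x by (simp_all add: \<beta>_def mean_exponent_def)
        then show ?thesis using ln_min_le_log_interp[of F G p] pos p by (simp add: real_mean_simps)
      next
        case False
        obtain e where e: "\<beta> = ereal e" "e < 0" "1 / e = 1 / x + 1 / c"
        proof -
          have gt: "- ereal c < \<alpha>" using False \<alpha> by simp
          then have "j + 1 / c < 0" using x mult_neg_pos[OF x(3) c0]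
            by (auto simp: j divide_simps)
          then show ?thesis using mean_exponent_inverse[OF gt] x c0 that
            unfolding \<beta>_def j_def[symmetric] j by (metis less_irrefl divide_less_0_1_iff ereal_eq_0(1))
        qed
        have "rel_entropy p / e = rel_entropy p / x + rel_entropy p / c" using e(3) by (metis distrib_left times_divide_eq_right mult.right_neutral)
        then show ?thesis using ln_real_mean_le[of F G p e] pos p e by simp
      qed
      ultimately show ?thesis using W[OF p(1,2)] p(3) by linarith
    next
      case z
      have ge: "log_interp lam s t \<le> ln (real_mean \<kappa> lam s t)" if "0 \<le> \<kappa>" "0 < s" "0 < t" for \<kappa> s t
      proof (cases "\<kappa> = 0")
        case False
        then show ?thesis using ln_real_mean_ge_ereal[of s t lam \<kappa>] that lam by (simp add: rel_entropy_lam)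
      qed (use that in \<open>simp add: ln_real_mean_zero\<close>)
      have "log_interp lam a b \<le> ln (real_mean \<alpha> lam a b)" using z ge pos by auto
      moreover have "(1 - c) * log_interp lam u v \<le> (1 - c) * ln (real_mean (ereal c) lam u v)"
        using z ge pos by (intro scaled) (auto simp: zero_ereal_def)
      moreover have "ln (real_mean \<beta> lam F G) \<le> log_interp lam F G"
      proof (cases "\<alpha> = - ereal c")
        case True
        then have "\<beta> = -\<infinity>" by (simp_all add: \<beta>_def mean_exponent_def)
        then show ?thesis using ln_min_le_log_interp[of F G lam] pos lam by (simp add: real_mean_simps)
      next
        case False
        then have "\<beta> = 0" using z alpha_cases unfolding \<beta>_def mean_exponent_def
          by (auto simp: zero_ereal_def)
        then show ?thesis using pos by (simp add: ln_real_mean_zero)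
      qed
      ultimately show ?thesis using W[OF lam] by (simp add: rel_entropy_lam)
    qed
  qed
  also have "\<dots> = ln (real_mean \<alpha> lam a b * real_mean (ereal c) lam u v powr (1 - c) * W)"
    using W0 real_mean_pos[of a b \<alpha>] real_mean_pos[of u v "ereal c"] pos by (simp add: ln_mult ln_powr)
  finally show ?thesis
    using W0 real_mean_pos[of a b \<alpha>] real_mean_pos[of u v "ereal c"] real_mean_pos[of F G \<beta>] pos
    unfolding \<beta>_def[symmetric] W_def[symmetric] by simp
qed

section \<open>Continuity and boundary values of power means\<close>

lemma epowr_tendsto:
  assumes pos: "\<And>n. 0 < (x n :: real)" and lim: "(\<lambda>n. ennreal (x n)) \<longlonglongrightarrow> F"
  shows "(\<lambda>n. epowr (ennreal (x n)) r) \<longlonglongrightarrow> epowr F r"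
proof (cases "r = 0")
  case r: False
  have eq: "(\<lambda>n. epowr (ennreal (x n)) r) = (\<lambda>n. ennreal (x n powr r))"
    using pos by (simp add: epowr_ennreal)
  have expln: "(\<lambda>n. x n powr r) = (\<lambda>n. exp (r * ln (x n)))"
    using pos by (auto simp: powr_def less_imp_neq[symmetric])
  show ?thesis
  proof (cases F)
    case (real y)
    then have x: "x \<longlonglongrightarrow> y" using lim pos by (simp add: less_imp_le)
    show ?thesis
    proof (cases "y = 0")
      case False
      then have "(\<lambda>n. x n powr r) \<longlonglongrightarrow> y powr r" using x by (intro tendsto_intros) auto
      then show ?thesis using real False unfolding eq by (simp add: epowr_ennreal)
    next
      case y: True
      have "filterlim x (at_right 0) sequentially"
        unfolding filterlim_at using x pos y by (auto intro!: always_eventually simp: less_imp_neq[symmetric])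
      then have l: "LIM n sequentially. ln (x n) :> at_bot"
        by (rule filterlim_compose[OF ln_at_0])
      show ?thesis
      proof (cases "r < 0")
        case True
        have "LIM n sequentially. x n powr r :> at_top"
          proof -
          have "LIM n sequentially. (- r) * (- ln (x n)) :> at_top"
            using True l by (intro filterlim_tendsto_pos_mult_at_top[OF tendsto_const])
              (simp_all add: filterlim_uminus_at_top)
          then show ?thesis
            unfolding expln by (intro filterlim_compose[OF exp_at_top]) simp
        qed
        then show ?thesis using real y True unfolding eq by (simp add: epowr_def ennreal_tendsto_top_eq_at_top)
      next
        case False
        then have "0 < r" using r by simp
        have "(\<lambda>n. x n powr r) \<longlonglongrightarrow> 0"
          unfolding expln
          by (intro filterlim_compose[OF exp_at_bot] filterlim_tendsto_pos_mult_at_bot[OF tendsto_const \<open>0 < r\<close> l])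
        then have "(\<lambda>n. ennreal (x n powr r)) \<longlonglongrightarrow> ennreal 0" by (rule tendsto_ennrealI)
        then show ?thesis using real y r False unfolding eq by (simp add: epowr_def)
      qed
    qed
  next
    case top
    then have xt: "LIM n sequentially. x n :> at_top" using lim by (simp add: ennreal_tendsto_top_eq_at_top)
    then have l: "LIM n sequentially. ln (x n) :> at_top"
      by (rule filterlim_compose[OF ln_at_top])
    show ?thesis
    proof (cases "r < 0")
      case True
      have "(\<lambda>n. x n powr r) \<longlonglongrightarrow> 0" using tendsto_neg_powr[OF True xt] .
      then have "(\<lambda>n. ennreal (x n powr r)) \<longlonglongrightarrow> ennreal 0" by (rule tendsto_ennrealI)
      then show ?thesis using top True unfolding eq by (simp add: epowr_def)
    next
      case False
      then have "0 < r" using r by simp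
      have "LIM n sequentially. x n powr r :> at_top"
        unfolding expln by (intro filterlim_compose[OF exp_at_top] filterlim_tendsto_pos_mult_at_top[OF tendsto_const \<open>0 < r\<close> l])
      then show ?thesis using top r False unfolding eq by (simp add: epowr_def ennreal_tendsto_top_eq_at_top)
    qed
  qed
qed (simp add: epowr_def)

text \<open>The limits have to be positive because for \<open>\<alpha> = 0\<close> the mean is a product and jumps at
  \<open>(0, \<infinity>)\<close>.\<close>
lemma power_mean_tendsto:
  assumes pos: "\<And>n. 0 < (x n :: real)" "\<And>n. 0 < (y n :: real)"
    and lim: "(\<lambda>n. ennreal (x n)) \<longlonglongrightarrow> F" "(\<lambda>n. ennreal (y n)) \<longlonglongrightarrow> G"
    and FG: "0 < F" "0 < G"
  shows "(\<lambda>n. power_mean \<alpha> lam (ennreal (x n)) (ennreal (y n))) \<longlonglongrightarrow> power_mean \<alpha> lam F G"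
proof (cases \<alpha>)
  case (real r)
  show ?thesis
  proof (cases "r = 0")
    case True
    have nz: "epowr H s \<noteq> 0" if "0 < H" "0 < s" for H s
      using that by (cases H) (auto simp: epowr_def)
    have "(\<lambda>n. epowr (ennreal (x n)) (1 - lam) * epowr (ennreal (y n)) lam) \<longlonglongrightarrow> epowr F (1 - lam) * epowr G lam"
      using nz[OF FG(1), of "1 - lam"] nz[OF FG(2), of lam] lam
      by (intro tendsto_mult_ennreal epowr_tendsto pos lim) auto
    then show ?thesis using real True by (simp add: power_mean_def)
  next
    case False
    let ?s = "\<lambda>n. (1 - lam) * x n powr r + lam * y n powr r"
    have s: "ennreal (1 - lam) * epowr (ennreal (x n)) r + ennreal lam * epowr (ennreal (y n)) r = ennreal (?s n)" for n
      using lam pos[of n] by (simp add: epowr_ennreal ennreal_mult ennreal_plus)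
    have "(\<lambda>n. ennreal (?s n)) \<longlonglongrightarrow> ennreal (1 - lam) * epowr F r + ennreal lam * epowr G r"
      unfolding s[symmetric]
      by (intro tendsto_add ennreal_tendsto_cmult epowr_tendsto pos lim) auto
    then have "(\<lambda>n. epowr (ennreal (?s n)) (1 / r)) \<longlonglongrightarrow> epowr (ennreal (1 - lam) * epowr F r + ennreal lam * epowr G r) (1 / r)"
      using pos[THEN less_imp_neq] by (intro epowr_tendsto wsum_pos) (auto simp: less_le)
    then show ?thesis using real False by (simp add: power_mean_def s)
  qed
next
  case PInf
  then show ?thesis using lim by (auto simp: power_mean_def intro: tendsto_max)
next
  case MInf
  then show ?thesis using lim by (auto simp: power_mean_def intro: tendsto_min)
qed

lemma power_mean_zero:
  assumes "\<alpha> \<le> 0" "u = 0 \<or> v = 0"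
  shows "power_mean \<alpha> lam u v = 0"
proof (cases \<alpha>)
  case (real r)
  show ?thesis
  proof (cases "r = 0")
    case False
    then have r: "r < 0" using assms real by simp
    then have "epowr u r = \<infinity> \<or> epowr v r = \<infinity>" using assms by (auto simp: epowr_def)
    then have inf: "ennreal (1 - lam) * epowr u r + ennreal lam * epowr v r = \<infinity>"
      using lam by (auto simp: ennreal_mult_top ennreal_top_mult)
    have "power_mean \<alpha> lam u v = epowr (ennreal (1 - lam) * epowr u r + ennreal lam * epowr v r) (1 / r)"
      using real False by (simp add: power_mean_def)
    also have "\<dots> = 0" unfolding inf using r by (simp add: epowr_def)
    finally show ?thesis .
  qed (use real assms lam in \<open>auto simp: power_mean_def epowr_def\<close>)
qed (use assms in \<open>auto simp: power_mean_def\<close>)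

lemma power_mean_zero_zero: "power_mean \<alpha> lam 0 0 = 0"
proof (cases \<alpha>)
  case (real r)
  then show ?thesis
  proof (cases "r \<le> 0")
    case True
    then show ?thesis using real by (intro power_mean_zero) auto
  qed (simp add: power_mean_def epowr_def)
qed (auto simp: power_mean_def)

end

section \<open>The Brunn--Minkowski and Borell--Brascamp--Lieb inequalities on the line\<close>

text \<open>For compact sets the combination contains the translate of \<open>(1 - lam) K\<close> by \<open>lam\<close> times the
  least point of \<open>L\<close> and the translate of \<open>lam L\<close> by \<open>1 - lam\<close> times the greatest point of \<open>K\<close>.
  These lie on different sides of a common point, so their measures add. Inner regularity extends
  this to Borel sets; the superset \<open>C\<close> avoids measurability questions about the combination.\<close>
lemma brunn_minkowski_real:
  fixes A B C :: "real set"
  assumes lam: "0 < lam" "lam < 1"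
    and A: "A \<in> sets borel" "bounded A" "A \<noteq> {}"
    and B: "B \<in> sets borel" "bounded B" "B \<noteq> {}"
    and C: "C \<in> sets borel"
    and sub: "\<And>x y. x \<in> A \<Longrightarrow> y \<in> B \<Longrightarrow> (1 - lam) * x + lam * y \<in> C"
  shows "ennreal (1 - lam) * emeasure lborel A + ennreal lam * emeasure lborel B \<le> emeasure lborel C"
proof -
  have inner: "\<exists>K. compact K \<and> K \<noteq> {} \<and> K \<subseteq> S \<and> emeasure lborel S \<le> emeasure lborel K + ennreal e"
    if S: "S \<in> sets borel" "bounded S" "S \<noteq> {}" and e: "e > 0" for S :: "real set" and e
  proof -
    obtain a where a: "a \<in> S" using S by blast
    have "S \<in> sets lebesgue" using S by simp
    then obtain T where T: "closed T" "T \<subseteq> S" "emeasure lebesgue (S - T) < ennreal e"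
      using sets_lebesgue_inner_closed[OF _ e] by metis
    \<comment> \<open>The closed set \<open>T\<close> can be empty if \<open>S\<close> is small; adding a point of \<open>S\<close> costs nothing.\<close>
    have cT: "compact (insert a T)"
      using T S(2) by (simp add: compact_eq_bounded_closed bounded_subset)
    have Tb: "T \<in> sets borel" using T by simp
    have "emeasure lborel S \<le> emeasure lborel (insert a T \<union> (S - T))"
      using S Tb by (intro emeasure_mono) auto
    also have "\<dots> \<le> emeasure lborel (insert a T) + emeasure lborel (S - T)"
      using S Tb by (intro emeasure_subadditive) auto
    also have "emeasure lborel (S - T) \<le> ennreal e"
      using T(3) S Tb by (simp add: main_part_sets emeasure_completion)
    finally show ?thesis using cT a T(2) by (intro exI[of _ "insert a T"]) auto
  qed
  have compact_case: "ennreal (1 - lam) * emeasure lborel K + ennreal lam * emeasure lborel L \<le> emeasure lborel C"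
    if K: "compact K" "K \<noteq> {}" "K \<subseteq> A" and L: "compact L" "L \<noteq> {}" "L \<subseteq> B" for K L
  proof -
    obtain m where m: "m \<in> K" "\<And>x. x \<in> K \<Longrightarrow> x \<le> m" using compact_attains_sup[OF K(1,2)] by blast
    obtain n where n: "n \<in> L" "\<And>x. x \<in> L \<Longrightarrow> n \<le> x" using compact_attains_inf[OF L(1,2)] by blast
    define K' where "K' = (\<lambda>x. (1 - lam) *\<^sub>R x + lam * n) ` K"
    define L' where "L' = (\<lambda>x. lam *\<^sub>R x + (1 - lam) * m) ` L"
    define z where "z = (1 - lam) * m + lam * n"
    have cK: "compact K'" unfolding K'_def
      by (intro compact_continuous_image K continuous_intros)
    have cL: "compact L'" unfolding L'_def
      by (intro compact_continuous_image L continuous_intros)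
    have bK: "K' \<in> sets borel" "L' \<in> sets borel" "K \<in> sets borel" "L \<in> sets borel"
      using cK cL K L by (auto simp: compact_imp_closed)
    have sub': "K' \<union> L' \<subseteq> C"
      using sub m n K L unfolding K'_def L'_def by (auto simp: subset_iff add.commute)
    have inter: "K' \<inter> L' \<subseteq> {z}"
    proof
      fix w assume "w \<in> K' \<inter> L'"
      then obtain x y where xy: "x \<in> K" "y \<in> L" "w = (1 - lam) * x + lam * n" "w = lam * y + (1 - lam) * m"
        unfolding K'_def L'_def by auto
      have "(1 - lam) * x \<le> (1 - lam) * m" "lam * n \<le> lam * y"
        using m n xy lam by (auto intro!: mult_left_mono)
      then have "w = z" unfolding z_def using xy(3,4) by linarith
      then show "w \<in> {z}" by simp
    qed
    have mK: "emeasure lborel K' = ennreal (1 - lam) * emeasure lborel K"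
    proof -
      have "emeasure lebesgue K' = \<bar>1 - lam\<bar> ^ DIM(real) * emeasure lebesgue K"
        unfolding K'_def by (rule emeasure_lebesgue_affine)
      then show ?thesis using bK lam by (simp add: emeasure_completion)
    qed
    have mL: "emeasure lborel L' = ennreal lam * emeasure lborel L"
    proof -
      have "emeasure lebesgue L' = \<bar>lam\<bar> ^ DIM(real) * emeasure lebesgue L"
        unfolding L'_def by (rule emeasure_lebesgue_affine)
      then show ?thesis using bK lam by (simp add: emeasure_completion)
    qed
    have "emeasure lborel K' = emeasure lborel (K' - {z})"
      using bK by (intro emeasure_Diff_null_set[symmetric]) auto
    then have "emeasure lborel K' + emeasure lborel L' = emeasure lborel (K' - {z}) + emeasure lborel L'"
      by simp
    also have "\<dots> = emeasure lborel ((K' - {z}) \<union> L')"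
      using bK inter by (intro plus_emeasure) auto
    also have "\<dots> \<le> emeasure lborel C"
      using sub' C bK by (intro emeasure_mono) auto
    finally show ?thesis using mK mL by simp
  qed
  show ?thesis
  proof (rule ennreal_le_epsilon)
    fix e :: real assume e: "0 < e"
    obtain K where K: "compact K" "K \<noteq> {}" "K \<subseteq> A" "emeasure lborel A \<le> emeasure lborel K + ennreal e"
      using inner[OF A e] by blast
    obtain L where L: "compact L" "L \<noteq> {}" "L \<subseteq> B" "emeasure lborel B \<le> emeasure lborel L + ennreal e"
      using inner[OF B e] by blast
    have "ennreal (1 - lam) * emeasure lborel A + ennreal lam * emeasure lborel B
      \<le> ennreal (1 - lam) * (emeasure lborel K + ennreal e) + ennreal lam * (emeasure lborel L + ennreal e)"
      by (intro add_mono mult_left_mono K L) auto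
    also have "\<dots> = (ennreal (1 - lam) * emeasure lborel K + ennreal lam * emeasure lborel L)
        + (ennreal (1 - lam) + ennreal lam) * ennreal e"
      by (simp add: algebra_simps)
    also have "(ennreal (1 - lam) + ennreal lam) = 1"
      using lam by (simp flip: ennreal_plus)
    also have "(ennreal (1 - lam) * emeasure lborel K + ennreal lam * emeasure lborel L) + 1 * ennreal e
      \<le> emeasure lborel C + ennreal e"
      using compact_case[OF K(1-3) L(1-3)] by (simp add: add_mono)
    finally show "ennreal (1 - lam) * emeasure lborel A + ennreal lam * emeasure lborel B \<le> emeasure lborel C + ennreal e" .
  qed
qed

text \<open>The two halves of the layer-cake formula that are needed. Levels are measured relative to a
  height, \<open>D\<close> or \<open>A\<close>, so that \<open>t\<close> runs through \<open>(0, 1)\<close> for different functions alike.\<close>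
lemma layer_cake_le:
  fixes h :: "real \<Rightarrow> ennreal"
  assumes [measurable]: "h \<in> borel_measurable borel" and D: "0 < D"
  shows "ennreal D * (\<integral>\<^sup>+t\<in>{0<..<1}. emeasure lborel {x. ennreal (t * D) \<le> h x} \<partial>lborel) \<le> (\<integral>\<^sup>+x. h x \<partial>lborel)"
proof -
  have "(\<integral>\<^sup>+t\<in>{0<..<1}. emeasure lborel {x. ennreal (t * D) \<le> h x} \<partial>lborel)
     = (\<integral>\<^sup>+t. (\<integral>\<^sup>+x. indicator {t \<in> {0<..<1}. ennreal (t * D) \<le> h x} t \<partial>lborel) \<partial>lborel)"
    by (intro nn_integral_cong)
       (auto simp: indicator_def nn_integral_indicator[symmetric] simp del: nn_integral_indicator)
  also have "\<dots> = (\<integral>\<^sup>+x. (\<integral>\<^sup>+t. indicator {t \<in> {0<..<1}. ennreal (t * D) \<le> h x} t \<partial>lborel) \<partial>lborel)"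
    by (rule lborel_pair.Fubini') simp
  also have "\<dots> = (\<integral>\<^sup>+x. emeasure lborel {t \<in> {0<..<1}. ennreal (t * D) \<le> h x} \<partial>lborel)"
    by simp
  finally have eq: "(\<integral>\<^sup>+t\<in>{0<..<1}. emeasure lborel {x. ennreal (t * D) \<le> h x} \<partial>lborel) = \<dots>" .
  have "ennreal D * emeasure lborel {t \<in> {0<..<1}. ennreal (t * D) \<le> h x} \<le> h x" for x
  proof (cases "h x")
    case (real y)
    have "{t \<in> {0<..<1}. ennreal (t * D) \<le> h x} \<subseteq> {0..y / D}"
      using D real by (auto simp: ennreal_le_iff field_simps)
    then have "emeasure lborel {t \<in> {0<..<1}. ennreal (t * D) \<le> h x} \<le> emeasure lborel {0..y/D}"
      by (intro emeasure_mono) auto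
    then have "ennreal D * emeasure lborel {t \<in> {0<..<1}. ennreal (t * D) \<le> h x} \<le> ennreal D * ennreal (y / D)"
      using D real by (intro mult_left_mono) auto
    then show ?thesis using D real by (simp flip: ennreal_mult)
  qed simp
  then show ?thesis
    unfolding eq by (subst nn_integral_cmult[symmetric]) (auto intro!: nn_integral_mono)
qed

lemma layer_cake_ge:
  fixes f :: "real \<Rightarrow> real"
  assumes [measurable]: "f \<in> borel_measurable borel" and nn: "\<And>x. 0 \<le> f x" and le: "\<And>x. f x \<le> A" and A: "0 < A"
  shows "(\<integral>\<^sup>+x. ennreal (f x) \<partial>lborel) \<le> ennreal A * (\<integral>\<^sup>+t\<in>{0<..<1}. emeasure lborel {x. t * A < f x} \<partial>lborel)"
proof -
  have "(\<integral>\<^sup>+t\<in>{0<..<1}. emeasure lborel {x. t * A < f x} \<partial>lborel)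
     = (\<integral>\<^sup>+t. (\<integral>\<^sup>+x. indicator {t \<in> {0<..<1}. t * A < f x} t \<partial>lborel) \<partial>lborel)"
    by (intro nn_integral_cong)
       (auto simp: indicator_def nn_integral_indicator[symmetric] simp del: nn_integral_indicator)
  also have "\<dots> = (\<integral>\<^sup>+x. (\<integral>\<^sup>+t. indicator {t \<in> {0<..<1}. t * A < f x} t \<partial>lborel) \<partial>lborel)"
    by (rule lborel_pair.Fubini') simp
  also have "\<dots> = (\<integral>\<^sup>+x. emeasure lborel {t \<in> {0<..<1}. t * A < f x} \<partial>lborel)"
    by simp
  finally have eq: "(\<integral>\<^sup>+t\<in>{0<..<1}. emeasure lborel {x. t * A < f x} \<partial>lborel) = \<dots>" .
  have "ennreal (f x) \<le> ennreal A * emeasure lborel {t \<in> {0<..<1}. t * A < f x}" for x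
  proof -
    have "{0<..<f x / A} \<subseteq> {t \<in> {0<..<1}. t * A < f x}"
      using A le[of x] by (auto simp: field_simps) (smt (verit) mult_le_cancel_right1)
    then have "emeasure lborel {0<..<f x / A} \<le> emeasure lborel {t \<in> {0<..<1}. t * A < f x}"
      by (intro emeasure_mono) auto
    then have "ennreal A * ennreal (f x / A) \<le> ennreal A * emeasure lborel {t \<in> {0<..<1}. t * A < f x}"
      using A nn[of x] by (intro mult_left_mono) auto
    then show ?thesis using A nn[of x] by (simp flip: ennreal_mult)
  qed
  then show ?thesis
    unfolding eq by (subst nn_integral_cmult[symmetric]) (auto intro!: nn_integral_mono)
qed

text \<open>The hypothesis on \<open>K\<close> is the infinitesimal form of the inequality: it is what the change of
  variables in a transport argument would require. Level sets give the same conclusion without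
  transport. Let \<open>A = sup f\<close>, \<open>B = sup g\<close> and \<open>E = (1 - lam) F / A + lam G / B\<close>. Where
  \<open>f x > t A\<close> and \<open>g y > t B\<close>, the weight in the hypothesis is at most \<open>E / t\<close>, hence
  \<open>h \<ge> t K / E\<close> at the combination. For each \<open>t < 1\<close> both level sets are non-empty, so the
  inequality on the line applies, and integration over \<open>t\<close> bounds the integral of \<open>h\<close> below by
  \<open>(K / E) E = K\<close>.\<close>
lemma borell_brascamp_lieb_real:
  fixes f g :: "real \<Rightarrow> real" and h :: "real \<Rightarrow> ennreal"
  assumes lam: "0 < lam" "lam < 1"
    and meas [measurable]: "f \<in> borel_measurable borel" "g \<in> borel_measurable borel" "h \<in> borel_measurable borel"
    and nn: "\<And>x. 0 \<le> f x" "\<And>x. 0 \<le> g x"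
    and bdd: "\<And>x. f x \<le> M" "\<And>x. g x \<le> M"
    and supp: "\<And>x. f x \<noteq> 0 \<Longrightarrow> x \<in> {p..q}" "\<And>x. g x \<noteq> 0 \<Longrightarrow> x \<in> {p..q}"
    and F: "(\<integral>\<^sup>+x. ennreal (f x) \<partial>lborel) = ennreal F" "0 < F"
    and G: "(\<integral>\<^sup>+x. ennreal (g x) \<partial>lborel) = ennreal G" "0 < G"
    and key: "\<And>x y. 0 < f x \<Longrightarrow> 0 < g y \<Longrightarrow>
      ennreal K \<le> h ((1 - lam) * x + lam * y) * ennreal ((1 - lam) * (F / f x) + lam * (G / g y))"
  shows "ennreal K \<le> (\<integral>\<^sup>+x. h x \<partial>lborel)"
proof (cases "0 < K")
  case K: True
  define A where "A = (SUP x. f x)"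
  define B where "B = (SUP x. g x)"
  have leA: "f x \<le> A" for x unfolding A_def using bdd by (intro cSUP_upper bdd_aboveI2) auto
  have leB: "g x \<le> B" for x unfolding B_def using bdd by (intro cSUP_upper bdd_aboveI2) auto
  have "\<exists>x. 0 < f x"
  proof (rule ccontr)
    assume "\<not> (\<exists>x. 0 < f x)"
    then have "f x = 0" for x using nn(1)[of x] by (metis less_eq_real_def)
    then show False using F by simp
  qed
  then have A0: "0 < A" using leA by (meson less_le_trans)
  have "\<exists>x. 0 < g x"
  proof (rule ccontr)
    assume "\<not> (\<exists>x. 0 < g x)"
    then have "g x = 0" for x using nn(2)[of x] by (metis less_eq_real_def)
    then show False using G by simp
  qed
  then have B0: "0 < B" using leB by (meson less_le_trans)
  define E where "E = (1 - lam) * (F / A) + lam * (G / B)"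
  have E0: "0 < E" unfolding E_def using lam F G A0 B0 by (simp add: add_pos_pos)
  define D where "D = K / E"
  have D0: "0 < D" using K E0 by (simp add: D_def)
  have level: "ennreal (1 - lam) * emeasure lborel {x. t * A < f x} + ennreal lam * emeasure lborel {x. t * B < g x}
      \<le> emeasure lborel {x. ennreal (t * D) \<le> h x}" if t: "t \<in> {0<..<1}" for t
  proof (rule brunn_minkowski_real[OF lam])
    have "t * A < A" "t * B < B" using t A0 B0 by auto
    moreover have "bdd_above (range f)" "bdd_above (range g)"
      using bdd by (auto simp: bdd_above_def)
    ultimately obtain x y where "t * A < f x" "t * B < g y"
      using less_cSUP_iff[of UNIV f "t * A"] less_cSUP_iff[of UNIV g "t * B"]
      unfolding A_def[symmetric] B_def[symmetric] by auto
    then show "{x. t * A < f x} \<noteq> {}" "{x. t * B < g x} \<noteq> {}" by auto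
    have "0 < t * A" "0 < t * B" using t A0 B0 by auto
    then have "{x. t * A < f x} \<subseteq> {p..q}" "{x. t * B < g x} \<subseteq> {p..q}" 
      using supp by force+
    then show "bounded {x. t * A < f x}" "bounded {x. t * B < g x}"
      by (blast intro: bounded_subset[OF bounded_closed_interval])+
    fix x y assume "x \<in> {x. t * A < f x}" "y \<in> {x. t * B < g x}"
    then have xy: "t * A < f x" "t * B < g y" by auto
    then have pos: "0 < f x" "0 < g y" using \<open>0 < t * A\<close> \<open>0 < t * B\<close> by auto
    have "F / f x \<le> F / (t * A)" using xy F \<open>0 < t * A\<close> pos by (intro divide_left_mono) auto
    moreover have "G / g y \<le> G / (t * B)" using xy G \<open>0 < t * B\<close> pos by (intro divide_left_mono) auto
    ultimately have "(1 - lam) * (F / f x) + lam * (G / g y) \<le> (1 - lam) * (F / (t * A)) + lam * (G / (t * B))"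
      using lam by (intro add_mono mult_left_mono) auto
    also have "\<dots> = E / t" using t by (simp add: E_def add_divide_distrib mult.commute)
    finally have le: "(1 - lam) * (F / f x) + lam * (G / g y) \<le> E / t" .
    let ?h = "h ((1 - lam) * x + lam * y)"
    have hh: "ennreal K \<le> ?h * ennreal (E / t)"
      by (rule order_trans[OF key[OF pos]]) (intro mult_left_mono ennreal_leI le, simp)
    have "ennreal (t * D) = ennreal K * ennreal (t / E)"
      using t E0 K by (simp add: D_def flip: ennreal_mult)
    also have "\<dots> \<le> ?h * ennreal (E / t) * ennreal (t / E)"
      by (intro mult_right_mono hh) simp
    also have "\<dots> = ?h" using t E0 by (simp add: mult.assoc flip: ennreal_mult)
    finally show "(1 - lam) * x + lam * y \<in> {x. ennreal (t * D) \<le> h x}" by simp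
  qed simp_all
  let ?IA = "\<integral>\<^sup>+t\<in>{0<..<1}. emeasure lborel {x. t * A < f x} \<partial>lborel"
  let ?IB = "\<integral>\<^sup>+t\<in>{0<..<1}. emeasure lborel {x. t * B < g x} \<partial>lborel"
  have IA: "ennreal (F / A) \<le> ?IA"
  proof -
    have "ennreal (F / A) = ennreal (1 / A) * ennreal F" using A0 F by (simp flip: ennreal_mult)
    also have "\<dots> \<le> ennreal (1 / A) * (ennreal A * ?IA)"
      using layer_cake_ge[OF meas(1) nn(1) leA A0] F by (intro mult_left_mono) auto
    also have "\<dots> = ?IA" using A0 by (simp flip: ennreal_mult mult.assoc)
    finally show ?thesis .
  qed
  have IB: "ennreal (G / B) \<le> ?IB"
  proof -
    have "ennreal (G / B) = ennreal (1 / B) * ennreal G" using B0 G by (simp flip: ennreal_mult)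
    also have "\<dots> \<le> ennreal (1 / B) * (ennreal B * ?IB)"
      using layer_cake_ge[OF meas(2) nn(2) leB B0] G by (intro mult_left_mono) auto
    also have "\<dots> = ?IB" using B0 by (simp flip: ennreal_mult mult.assoc)
    finally show ?thesis .
  qed
  have mA: "(\<lambda>t. emeasure lborel {x. t * A < f x}) \<in> borel_measurable borel" by measurable
  have mB: "(\<lambda>t. emeasure lborel {x. t * B < g x}) \<in> borel_measurable borel" by measurable
  have "ennreal K = ennreal D * (ennreal (1 - lam) * ennreal (F / A) + ennreal lam * ennreal (G / B))"
    using lam F G A0 B0 E0 K
    by (simp add: D_def flip: ennreal_mult ennreal_plus) (simp add: E_def)
  also have "\<dots> \<le> ennreal D * (ennreal (1 - lam) * ?IA + ennreal lam * ?IB)"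
    by (intro mult_left_mono add_mono IA IB) auto
  also have "ennreal (1 - lam) * ?IA + ennreal lam * ?IB
     = (\<integral>\<^sup>+t\<in>{0<..<1}. ennreal (1 - lam) * emeasure lborel {x. t * A < f x}
          + ennreal lam * emeasure lborel {x. t * B < g x} \<partial>lborel)"
    using mA mB by (simp add: nn_integral_cmult[symmetric] nn_integral_add[symmetric] distrib_right mult.assoc)
  also have "\<dots> \<le> (\<integral>\<^sup>+t\<in>{0<..<1}. emeasure lborel {x. ennreal (t * D) \<le> h x} \<partial>lborel)"
    using level by (intro nn_integral_mono) (auto simp: indicator_def)
  also have "ennreal D * \<dots> \<le> (\<integral>\<^sup>+x. h x \<partial>lborel)"
    by (rule layer_cake_le[OF meas(3) D0])
  finally show ?thesis by (simp add: mult_left_mono)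
qed (simp add: ennreal_neg)

section \<open>A Brunn--Minkowski inequality in the plane with a power mean in each coordinate\<close>

text \<open>The coordinate in which \<open>M\<^sub>c\<close> is the arithmetic mean, normalised so that its derivative is
  \<open>u\<^sup>c\<^sup>-\<^sup>1\<close> for every \<open>c\<close>. It is increasing also for \<open>c < 0\<close>.\<close>
definition mean_coord :: "real \<Rightarrow> real \<Rightarrow> real" where
  "mean_coord c u = (if c = 0 then ln u else (u powr c - 1) / c)"

text \<open>The inverse of this coordinate. It is meaningful where \<open>c = 0\<close> or \<open>1 + c x > 0\<close>, a condition that
  holds on every interval between the coordinates of two positive numbers.\<close>
definition mean_param :: "real \<Rightarrow> real \<Rightarrow> real" where
  "mean_param c x = (if c = 0 then exp x else (1 + c * x) powr (1 / c))"

lemma mean_param_coord: "0 < u \<Longrightarrow> mean_param c (mean_coord c u) = u"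
  by (simp add: mean_param_def mean_coord_def powr_powr)

lemma mean_coord_less: "0 < u \<Longrightarrow> u < v \<Longrightarrow> mean_coord c u < mean_coord c v"
  by (cases c "0 :: real" rule: linorder_cases)
     (simp_all add: mean_coord_def divide_less_cancel powr_less_mono2 powr_less_mono2_neg)

lemma mean_coord_domain:
  assumes "0 < p" "0 < q" "x \<in> {mean_coord c p..mean_coord c q}"
  shows "c = 0 \<or> 0 < 1 + c * x"
proof (cases c "0 :: real" rule: linorder_cases)
  case greater
  then have "p powr c - 1 \<le> c * x" using assms by (simp add: mean_coord_def field_simps)
  then show ?thesis using assms by (smt (verit) powr_gt_zero)
next
  case less
  then have "q powr c - 1 \<le> c * x" using assms by (simp add: mean_coord_def field_simps)
  then show ?thesis using assms by (smt (verit) powr_gt_zero)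
qed simp

lemma mean_param_pos: "c = 0 \<or> 0 < 1 + c * x \<Longrightarrow> 0 < mean_param c x"
  by (auto simp: mean_param_def)

lemma mean_param_mono:
  assumes "c = 0 \<or> 0 < 1 + c * x" "c = 0 \<or> 0 < 1 + c * y" "x \<le> y"
  shows "mean_param c x \<le> mean_param c y"
proof (cases c "0 :: real" rule: linorder_cases)
  case greater
  then show ?thesis using assms by (auto simp: mean_param_def intro!: powr_mono2)
next
  case less
  then show ?thesis using assms by (auto simp: mean_param_def intro!: powr_mono2')
qed (use assms in \<open>auto simp: mean_param_def\<close>)

text \<open>The derivative is a power of the function itself; this is the source of the factor
  \<open>M\<^sub>c(u, v)\<^sup>1\<^sup>-\<^sup>c\<close> in the pointwise estimate.\<close>
lemma mean_param_deriv:
  assumes "c = 0 \<or> 0 < 1 + c * x"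
  shows "(mean_param c has_real_derivative mean_param c x powr (1 - c)) (at x)"
proof (cases "c = 0")
  case True
  then have "mean_param c = exp" by (auto simp: mean_param_def)
  then show ?thesis using True by (auto intro!: derivative_eq_intros)
next
  case False
  then have "mean_param c = (\<lambda>x. (1 + c * x) powr (1 / c))" by (auto simp: mean_param_def)
  moreover have "(1 - c) / c = 1 / c - 1" using False by (simp add: field_simps)
  ultimately show ?thesis using False assms
    by (auto intro!: derivative_eq_intros simp: powr_powr)
qed

lemma mean_param_comb:
  assumes lam: "0 < lam" "lam < 1" and x: "c = 0 \<or> 0 < 1 + c * x" and y: "c = 0 \<or> 0 < 1 + c * y"
  shows "mean_param c ((1 - lam) * x + lam * y) = real_mean (ereal c) lam (mean_param c x) (mean_param c y)"
proof (cases "c = 0")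
  case True
  then show ?thesis by (simp add: mean_param_def real_mean_def exp_add exp_powr_real mult.commute)
next
  case False
  then have "(1 - lam) * mean_param c x powr c + lam * mean_param c y powr c = 1 + c * ((1 - lam) * x + lam * y)"
    using x y by (simp add: mean_param_def powr_powr algebra_simps)
  then show ?thesis using False by (simp add: real_mean_simps) (simp add: mean_param_def)
qed

lemma mean_param_measurable [measurable]: "mean_param c \<in> borel_measurable borel"
  unfolding mean_param_def by measurable

lemma nn_integral_mean_param:
  fixes \<phi> :: "real \<Rightarrow> ennreal"
  assumes [measurable]: "\<phi> \<in> borel_measurable borel" and pq: "0 < p" "p < q"
  shows "(\<integral>\<^sup>+u. \<phi> u * indicator {p..q} u \<partial>lborel)
    = (\<integral>\<^sup>+x. \<phi> (mean_param c x) * ennreal (mean_param c x powr (1 - c))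
          * indicator {mean_coord c p..mean_coord c q} x \<partial>lborel)"
proof -
  note dom = mean_coord_domain[of p q _ c]
  have "(\<integral>\<^sup>+u. \<phi> u * indicator {mean_param c (mean_coord c p)..mean_param c (mean_coord c q)} u \<partial>lborel)
    = (\<integral>\<^sup>+x. \<phi> (mean_param c x) * ennreal (mean_param c x powr (1 - c))
          * indicator {mean_coord c p..mean_coord c q} x \<partial>lborel)"
  proof (rule nn_integral_substitution_aux)
    show "continuous_on {mean_coord c p..mean_coord c q} (\<lambda>x. mean_param c x powr (1 - c))"
    proof (intro continuous_at_imp_continuous_on ballI)
      fix x assume "x \<in> {mean_coord c p..mean_coord c q}"
      then have "c = 0 \<or> 0 < 1 + c * x" using dom pq by auto
      then have "isCont (mean_param c) x" "0 < mean_param c x"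
        using mean_param_deriv DERIV_isCont mean_param_pos by blast+
      then show "isCont (\<lambda>x. mean_param c x powr (1 - c)) x" by (intro continuous_intros) auto
    qed
  qed (use pq dom in \<open>auto intro!: mean_param_deriv mean_coord_less\<close>)
  then show ?thesis using pq by (simp add: mean_param_coord)
qed

definition row :: "(real \<times> real) set \<Rightarrow> real \<Rightarrow> real set" where
  "row P u = {r. (r, u) \<in> P}"

lemma row_measurable [measurable]:
  assumes "P \<in> sets borel"
  shows "row P u \<in> sets borel" "(\<lambda>u. emeasure lborel (row P u)) \<in> borel_measurable borel"
proof -
  have P: "P \<in> sets (lborel \<Otimes>\<^sub>M lborel)" using assms unfolding lborel_prod by simp
  have eq: "row P u = (\<lambda>r. (r, u)) -` P" for u by (auto simp: row_def)
  show "row P u \<in> sets borel" using sets_Pair2[OF P] by (simp add: eq)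
  show "(\<lambda>u. emeasure lborel (row P u)) \<in> borel_measurable borel"
    using lborel_pair.measurable_emeasure_Pair2[OF P] by (simp add: eq)
qed

lemma emeasure_rows:
  assumes "P \<in> sets borel"
  shows "emeasure lborel P = (\<integral>\<^sup>+u. emeasure lborel (row P u) \<partial>lborel)"
proof -
  have "P \<in> sets (lborel \<Otimes>\<^sub>M lborel)" using assms unfolding lborel_prod by simp
  from lborel_pair.emeasure_pair_measure_alt2[OF this] show ?thesis
    by (simp add: lborel_prod row_def vimage_def)
qed

text \<open>The density of the area of \<open>P\<close> with respect to the transformed height \<open>x\<close>, for a region that
  is contained in a strip between the heights \<open>1 / N\<close> and \<open>N\<close>.\<close>
definition row_density :: "real \<Rightarrow> real \<Rightarrow> (real \<times> real) set \<Rightarrow> real \<Rightarrow> real" where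
  "row_density c N P x = measure lborel (row P (mean_param c x)) * mean_param c x powr (1 - c)
     * indicator {mean_coord c (1 / N)..mean_coord c N} x"

lemma row_box:
  assumes "P \<in> sets borel" "P \<subseteq> {0<..<N} \<times> {1 / N<..<N}" "1 < N"
  shows "emeasure lborel (row P u) = ennreal (measure lborel (row P u))"
    and "measure lborel (row P u) \<le> N"
    and "u \<notin> {1 / N<..<N} \<Longrightarrow> row P u = {}"
proof -
  have sub: "row P u \<subseteq> {0<..<N}" using assms by (auto simp: row_def)
  then have "emeasure lborel (row P u) \<le> emeasure lborel {0<..<N}"
    by (intro emeasure_mono) auto
  then have le: "emeasure lborel (row P u) \<le> ennreal N" using assms by simp
  then show eq: "emeasure lborel (row P u) = ennreal (measure lborel (row P u))"
    by (intro emeasure_eq_ennreal_measure) (auto simp: top_unique)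
  show "measure lborel (row P u) \<le> N" using le assms unfolding eq by simp
  show "u \<notin> {1 / N<..<N} \<Longrightarrow> row P u = {}" using assms by (auto simp: row_def)
qed

lemma row_density:
  assumes P [measurable]: "P \<in> sets borel" and box: "P \<subseteq> {0<..<N} \<times> {1 / N<..<N}" and N: "1 < N" and c: "c \<le> 1"
  shows "row_density c N P \<in> borel_measurable borel"
    and "0 \<le> row_density c N P x"
    and "row_density c N P x \<le> N * N powr (1 - c)"
    and "row_density c N P x \<noteq> 0 \<Longrightarrow> x \<in> {mean_coord c (1 / N)..mean_coord c N}"
    and "(\<integral>\<^sup>+x. ennreal (row_density c N P x) \<partial>lborel) = emeasure lborel P"
proof -
  have NN: "0 < 1 / N" "0 < N" "1 / N < N" using N by (auto simp: field_simps) (smt (verit) mult_less_cancel_right2)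
  show "row_density c N P \<in> borel_measurable borel"
    unfolding row_density_def measure_def by measurable
  show "0 \<le> row_density c N P x" by (simp add: row_density_def)
  show "row_density c N P x \<noteq> 0 \<Longrightarrow> x \<in> {mean_coord c (1 / N)..mean_coord c N}"
    by (auto simp: row_density_def split: split_indicator_asm)
  show "row_density c N P x \<le> N * N powr (1 - c)"
  proof (cases "x \<in> {mean_coord c (1 / N)..mean_coord c N}")
    case True
    have dom: "c = 0 \<or> 0 < 1 + c * y" if "y \<in> {mean_coord c (1 / N)..mean_coord c N}" for y
      using mean_coord_domain[OF NN(1,2) that] .
    have "mean_coord c N \<in> {mean_coord c (1 / N)..mean_coord c N}" using True by simp
    then have "mean_param c x \<le> N"
      using mean_param_mono[of c x "mean_coord c N"] dom True NN by (metis atLeastAtMost_iff mean_param_coord)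
    then have "mean_param c x powr (1 - c) \<le> N powr (1 - c)"
      using mean_param_pos[OF dom[OF True]] c by (intro powr_mono2) auto
    then show ?thesis using True row_box(2)[OF P box N, of "mean_param c x"] NN
      by (auto simp: row_density_def intro!: mult_mono)
  qed (use NN in \<open>simp add: row_density_def\<close>)
  have "emeasure lborel P = (\<integral>\<^sup>+u. emeasure lborel (row P u) * indicator {1 / N..N} u \<partial>lborel)"
    unfolding emeasure_rows[OF P] using row_box(3)[OF P box N]
    by (intro nn_integral_cong) (force split: split_indicator)
  also have "\<dots> = (\<integral>\<^sup>+x. emeasure lborel (row P (mean_param c x)) * ennreal (mean_param c x powr (1 - c))
          * indicator {mean_coord c (1 / N)..mean_coord c N} x \<partial>lborel)"
    by (rule nn_integral_mean_param) (use NN in auto)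
  also have "\<dots> = (\<integral>\<^sup>+x. ennreal (row_density c N P x) \<partial>lborel)"
    by (intro nn_integral_cong) (auto simp: row_density_def row_box(1)[OF P box N] ennreal_mult split: split_indicator)
  finally show "(\<integral>\<^sup>+x. ennreal (row_density c N P x) \<partial>lborel) = emeasure lborel P" by simp
qed

text \<open>A row that is closed towards \<open>0\<close> is an interval starting at \<open>0\<close>, so its length tells which
  points belong to it.\<close>
lemma mem_row:
  assumes P: "P \<in> sets borel" and box: "P \<subseteq> {0<..<N} \<times> {1 / N<..<N}"
    and down: "\<And>r r' u. (r, u) \<in> P \<Longrightarrow> 0 < r' \<Longrightarrow> r' \<le> r \<Longrightarrow> (r', u) \<in> P"
    and r: "0 < r" "r < measure lborel (row P u)"
  shows "(r, u) \<in> P"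
proof (rule ccontr)
  assume "(r, u) \<notin> P"
  then have "row P u \<subseteq> {0<..<r}" using box down[of _ u r] r(1) by (force simp: row_def)
  then have "measure lborel (row P u) \<le> measure lborel {0<..<r}"
    by (intro measure_mono_fmeasurable) (use r in \<open>auto simp: P row_measurable fmeasurable_def\<close>)
  then show False using r by simp
qed

text \<open>The box makes the row densities bounded with bounded support and the areas finite, as the
  one-dimensional inequality demands.\<close>
lemma planar_brunn_minkowski_box:
  fixes P Q R :: "(real \<times> real) set"
  assumes lam: "0 < lam" "lam < 1" and c: "c \<le> 1" and \<alpha>: "- ereal c \<le> \<alpha>" and N: "1 < N"
    and P [measurable]: "P \<in> sets borel" "P \<subseteq> {0<..<N} \<times> {1 / N<..<N}"
    and Q [measurable]: "Q \<in> sets borel" "Q \<subseteq> {0<..<N} \<times> {1 / N<..<N}"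
    and R [measurable]: "R \<in> sets borel"
    and downP: "\<And>r r' u. (r, u) \<in> P \<Longrightarrow> 0 < r' \<Longrightarrow> r' \<le> r \<Longrightarrow> (r', u) \<in> P"
    and downQ: "\<And>r r' u. (r, u) \<in> Q \<Longrightarrow> 0 < r' \<Longrightarrow> r' \<le> r \<Longrightarrow> (r', u) \<in> Q"
    and comb: "\<And>r u s v. (r, u) \<in> P \<Longrightarrow> (s, v) \<in> Q \<Longrightarrow> (real_mean \<alpha> lam r s, real_mean (ereal c) lam u v) \<in> R"
    and F: "emeasure lborel P = ennreal F" "0 < F" and G: "emeasure lborel Q = ennreal G" "0 < G"
  shows "ennreal (real_mean (mean_exponent \<alpha> (ereal c)) lam F G) \<le> emeasure lborel R"
proof -
  define f where "f = row_density c N P"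
  define g where "g = row_density c N Q"
  define I where "I = {mean_coord c (1 / N)..mean_coord c N}"
  define h where "h x = emeasure lborel (row R (mean_param c x)) * ennreal (mean_param c x powr (1 - c)) * indicator I x" for x
  note f = row_density[OF P N c, folded f_def] and g = row_density[OF Q N c, folded g_def]
  have NN: "0 < 1 / N" "0 < N" "1 / N < N" using N by (auto simp: field_simps) (smt (verit) mult_less_cancel_right2)
  have "ennreal (real_mean (mean_exponent \<alpha> (ereal c)) lam F G) \<le> (\<integral>\<^sup>+x. h x \<partial>lborel)"
  proof (rule borell_brascamp_lieb_real[OF lam, where f = f and g = g and F = F and G = G])
    show "h \<in> borel_measurable borel" unfolding h_def I_def by measurable
    fix x y assume xy: "0 < f x" "0 < g y"
    then have I: "x \<in> I" "y \<in> I" unfolding I_def using f(4)[of x] g(4)[of y] by auto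
    then have z: "(1 - lam) * x + lam * y \<in> I"
      unfolding I_def using lam convexD_alt[of I x y lam] by (auto simp: I_def)
    have dom: "c = 0 \<or> 0 < 1 + c * x" "c = 0 \<or> 0 < 1 + c * y"
      using mean_coord_domain[OF NN(1,2)] I unfolding I_def by blast+
    define u where "u = mean_param c x"
    define v where "v = mean_param c y"
    define a where "a = measure lborel (row P u)"
    define b where "b = measure lborel (row Q v)"
    define T where "T = real_mean \<alpha> lam a b"
    define w where "w = real_mean (ereal c) lam u v"
    define W where "W = (1 - lam) * (F / (a * u powr (1 - c))) + lam * (G / (b * v powr (1 - c)))"
    have uv: "0 < u" "0 < v" using mean_param_pos dom by (auto simp: u_def v_def)
    have fx: "f x = a * u powr (1 - c)" using I by (simp add: f_def row_density_def a_def u_def I_def)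
    have gy: "g y = b * v powr (1 - c)" using I by (simp add: g_def row_density_def b_def v_def I_def)
    have ab: "0 < a" "0 < b" using xy uv unfolding fx gy by (auto simp: zero_less_mult_iff)
    have T0: "0 < T" unfolding T_def by (intro real_mean_pos lam ab)
    have zw: "mean_param c ((1 - lam) * x + lam * y) = w"
      unfolding w_def u_def v_def by (rule mean_param_comb[OF lam dom])
    \<comment> \<open>The end points of the rows may be missing; homogeneity of \<open>M\<^sub>\<alpha>\<close> reaches every \<open>t < T\<close>
      from points strictly inside.\<close>
    have "{0<..<T} \<subseteq> row R w"
    proof
      fix t assume t: "t \<in> {0<..<T}"
      define k where "k = t / T"
      have k: "0 < k" "k < 1" using t by (auto simp: k_def)
      have "(k * a, u) \<in> P" by (rule mem_row[OF P downP]) (use k ab in \<open>auto simp: a_def\<close>)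
      moreover have "(k * b, v) \<in> Q" by (rule mem_row[OF Q downQ]) (use k ab in \<open>auto simp: b_def\<close>)
      ultimately have "(real_mean \<alpha> lam (k * a) (k * b), w) \<in> R" unfolding w_def by (rule comb)
      moreover have "real_mean \<alpha> lam (k * a) (k * b) = t"
        using real_mean_scale[OF lam ab k(1)] T0 by (simp add: T_def[symmetric] k_def)
      ultimately show "t \<in> row R w" by (simp add: row_def)
    qed
    then have "emeasure lborel {0<..<T} \<le> emeasure lborel (row R w)" by (intro emeasure_mono) auto
    then have Tle: "ennreal T \<le> emeasure lborel (row R w)" using T0 by simp
    have W0: "0 \<le> W" unfolding W_def using lam F G ab by simp
    have "ennreal (real_mean (mean_exponent \<alpha> (ereal c)) lam F G) \<le> ennreal (T * w powr (1 - c) * W)"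
      unfolding T_def w_def W_def
      by (intro ennreal_leI three_factor_hoelder lam ab uv F G c \<alpha>)
    also have "\<dots> = ennreal T * ennreal (w powr (1 - c)) * ennreal W"
      using T0 W0 by (simp add: ennreal_mult)
    also have "\<dots> \<le> emeasure lborel (row R w) * ennreal (w powr (1 - c)) * ennreal W"
      by (intro mult_right_mono Tle) auto
    also have "\<dots> = h ((1 - lam) * x + lam * y) * ennreal W"
      using z by (simp add: h_def zw)
    finally show "ennreal (real_mean (mean_exponent \<alpha> (ereal c)) lam F G)
      \<le> h ((1 - lam) * x + lam * y) * ennreal ((1 - lam) * (F / f x) + lam * (G / g y))"
      unfolding W_def fx gy .
  qed (use f g F G in \<open>auto simp del: atLeastAtMost_iff\<close>)
  also have "\<dots> = (\<integral>\<^sup>+w. emeasure lborel (row R w) * indicator {1 / N..N} w \<partial>lborel)"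
    unfolding h_def I_def by (rule nn_integral_mean_param[symmetric]) (use NN in auto)
  also have "\<dots> \<le> emeasure lborel R"
    unfolding emeasure_rows[OF R] by (intro nn_integral_mono) (auto split: split_indicator)
  finally show ?thesis .
qed

text \<open>Exhaustion of the quadrant by boxes. The areas of the truncated regions are finite, and positive
  from some index on.\<close>
lemma planar_brunn_minkowski:
  fixes P Q R :: "(real \<times> real) set" and c :: real
  assumes lam: "0 < lam" "lam < 1" and c: "c \<le> 1" and \<alpha>: "- ereal c \<le> \<alpha>"
    and P [measurable]: "P \<in> sets borel" "P \<subseteq> {0<..} \<times> {0<..}"
    and Q [measurable]: "Q \<in> sets borel" "Q \<subseteq> {0<..} \<times> {0<..}"
    and R [measurable]: "R \<in> sets borel"
    and downP: "\<And>r r' u. (r, u) \<in> P \<Longrightarrow> 0 < r' \<Longrightarrow> r' \<le> r \<Longrightarrow> (r', u) \<in> P"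
    and downQ: "\<And>r r' u. (r, u) \<in> Q \<Longrightarrow> 0 < r' \<Longrightarrow> r' \<le> r \<Longrightarrow> (r', u) \<in> Q"
    and comb: "\<And>r u s v. (r, u) \<in> P \<Longrightarrow> (s, v) \<in> Q \<Longrightarrow> (real_mean \<alpha> lam r s, real_mean (ereal c) lam u v) \<in> R"
    and pos: "0 < emeasure lborel P" "0 < emeasure lborel Q"
  shows "power_mean (mean_exponent \<alpha> (ereal c)) lam (emeasure lborel P) (emeasure lborel Q) \<le> emeasure lborel R"
proof -
  define B where "B n = {0<..<real n} \<times> {1 / real n<..<real n}" for n
  have Bsets [measurable]: "B n \<in> sets borel" for n unfolding B_def by (intro borel_open open_Times) auto
  have Bmono: "B m \<subseteq> B n" if "m \<le> n" "0 < m" for m n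
  proof -
    have "1 / real n \<le> 1 / real m" using that by (simp add: frac_le)
    then show ?thesis using that unfolding B_def by force
  qed
  have lim: "(\<lambda>n. emeasure lborel (S \<inter> B (Suc n))) \<longlonglongrightarrow> emeasure lborel S"
    if S: "S \<in> sets borel" "S \<subseteq> {0<..} \<times> {0<..}" for S
  proof -
    have "S \<inter> B (Suc k) \<subseteq> S \<inter> B (Suc l)" if "k \<le> l" for k l
      using Bmono[of "Suc k" "Suc l"] that by auto
    then have "incseq (\<lambda>n. S \<inter> B (Suc n))" by (auto simp: incseq_def)
    moreover have "(\<Union>n. S \<inter> B (Suc n)) = S"
    proof -
      have "\<exists>n. p \<in> B (Suc n)" if p: "p \<in> S" for p
      proof -
        obtain r u where ru: "p = (r, u)" "0 < r" "0 < u" using S p by (cases p) auto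
        obtain n where n: "r + u + 1 / u < real n" using reals_Archimedean2 by blast
        have "0 < 1 / u" using ru by simp
        then have "r < real (Suc n)" "u < real (Suc n)" "1 / u < real (Suc n)" using n ru by linarith+
        moreover from this(3) have "1 / real (Suc n) < u" using ru by (simp add: field_simps)
        ultimately show ?thesis using ru by (auto simp: B_def)
      qed
      then show ?thesis by blast
    qed
    ultimately show ?thesis using S Lim_emeasure_incseq[of "\<lambda>n. S \<inter> B (Suc n)" lborel] by (auto simp: image_subset_iff)
  qed
  have fin: "emeasure lborel (S \<inter> B n) = ennreal (measure lborel (S \<inter> B n))" if [measurable]: "S \<in> sets borel" for S n
  proof -
    have "bounded (B n)" unfolding B_def by (intro bounded_Times) (auto intro: bounded_subset[OF bounded_closed_interval])
    then have "bounded (S \<inter> B n)" by (rule bounded_subset) simp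
    then have "emeasure lborel (S \<inter> B n) < \<infinity>" by (rule emeasure_bounded_finite)
    then show ?thesis by (intro emeasure_eq_ennreal_measure) auto
  qed
  have ev: "\<forall>\<^sub>F n in sequentially. 0 < measure lborel (S \<inter> B (Suc n))"
    if S: "S \<in> sets borel" "S \<subseteq> {0<..} \<times> {0<..}" "0 < emeasure lborel S" for S
    using order_tendstoD(1)[OF lim[OF S(1,2)] S(3)] unfolding fin[OF S(1)] by simp
  obtain n0 where n0: "\<And>n. n \<ge> n0 \<Longrightarrow> 0 < measure lborel (P \<inter> B (Suc n)) \<and> 0 < measure lborel (Q \<inter> B (Suc n))"
    using eventually_conj[OF ev[OF P pos(1)] ev[OF Q pos(2)]] unfolding eventually_sequentially by blast
  \<comment> \<open>Besides reaching positive areas, the index must give a box with \<open>N > 1\<close>.\<close>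
  define m where "m n = n + n0 + 2" for n
  define x where "x n = measure lborel (P \<inter> B (m n))" for n
  define y where "y n = measure lborel (Q \<inter> B (m n))" for n
  have xy: "0 < x n" "0 < y n" for n
    using n0[of "n + n0 + 1"] by (auto simp: x_def y_def m_def)
  have shift: "(\<lambda>n. ennreal (measure lborel (S \<inter> B (m n)))) \<longlonglongrightarrow> emeasure lborel S"
    if S: "S \<in> sets borel" "S \<subseteq> {0<..} \<times> {0<..}" for S
    using LIMSEQ_ignore_initial_segment[OF lim[OF S], of "n0 + 1"] unfolding fin[OF S(1)]
    by (simp add: m_def add.assoc)
  have "power_mean (mean_exponent \<alpha> (ereal c)) lam (ennreal (x n)) (ennreal (y n)) \<le> emeasure lborel R" for n
    unfolding power_mean_ennreal[OF lam xy]
  proof (rule planar_brunn_minkowski_box[OF lam c \<alpha>])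
    show "1 < real (m n)" by (simp add: m_def)
    show "P \<inter> B (m n) \<in> sets borel" "Q \<inter> B (m n) \<in> sets borel" by measurable
    show "emeasure lborel (P \<inter> B (m n)) = ennreal (x n)" "emeasure lborel (Q \<inter> B (m n)) = ennreal (y n)"
      by (simp_all add: x_def y_def fin)
  qed (use downP downQ comb xy in \<open>auto simp: B_def\<close>)
  moreover have "(\<lambda>n. power_mean (mean_exponent \<alpha> (ereal c)) lam (ennreal (x n)) (ennreal (y n)))
      \<longlonglongrightarrow> power_mean (mean_exponent \<alpha> (ereal c)) lam (emeasure lborel P) (emeasure lborel Q)"
    using shift[OF P] shift[OF Q] xy pos unfolding x_def[symmetric] y_def[symmetric]
    by (intro power_mean_tendsto lam) auto
  ultimately show ?thesis by (intro LIMSEQ_le_const2) auto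
qed

section \<open>Functionals on sets and the areas of their hypographs\<close>

text \<open>Strict inequality turns the supremum in the definition into a witness from the class, which
  handles superlevel sets inside and outside the class alike.\<close>
lemma value_on_less:
  assumes "u < value_on \<C> \<Phi> A"
  shows "\<exists>K\<in>\<C>. K \<subseteq> A \<and> u < \<Phi> K"
  using assms by (auto simp: value_on_def less_SUP_iff split: if_splits)

lemma value_on_upper:
  assumes "mono_on \<C> \<Phi>" "K \<in> \<C>" "K \<subseteq> A"
  shows "\<Phi> K \<le> value_on \<C> \<Phi> A"
  using assms by (auto simp: value_on_def intro: mono_onD SUP_upper)

lemma value_on_mono:
  assumes "mono_on \<C> \<Phi>" "A \<subseteq> B"
  shows "value_on \<C> \<Phi> A \<le> value_on \<C> \<Phi> B"
proof (rule dense_le)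
  fix u assume "u < value_on \<C> \<Phi> A"
  then obtain K where K: "K \<in> \<C>" "K \<subseteq> A" "u < \<Phi> K" using value_on_less by blast
  then have "\<Phi> K \<le> value_on \<C> \<Phi> B" using assms by (intro value_on_upper) auto
  with K(3) show "u \<le> value_on \<C> \<Phi> B" by simp
qed

lemma minkowski_comb_convex_body:
  fixes K0 K1 :: "'a::euclidean_space set"
  assumes "K0 \<in> convex_bodies" "K1 \<in> convex_bodies"
  shows "minkowski_comb lam K0 K1 \<in> convex_bodies"
proof -
  have eq: "minkowski_comb lam K0 K1 = {x + y | x y. x \<in> (*\<^sub>R) (1 - lam) ` K0 \<and> y \<in> (*\<^sub>R) lam ` K1}"
    unfolding minkowski_comb_def by auto
  have "compact (minkowski_comb lam K0 K1)"
    unfolding eq using assms by (intro compact_sums compact_scaling) (auto simp: convex_bodies_def)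
  moreover have "convex (minkowski_comb lam K0 K1)"
  proof -
    have "minkowski_comb lam K0 K1 = (\<Union>x\<in>(*\<^sub>R) (1 - lam) ` K0. \<Union>y\<in>(*\<^sub>R) lam ` K1. {x + y})"
      unfolding eq by auto
    also have "convex \<dots>"
      using assms by (intro convex_sums convex_scaling) (simp_all add: convex_bodies_def)
    finally show ?thesis .
  qed
  moreover have "minkowski_comb lam K0 K1 \<noteq> {}"
    using assms by (auto simp: convex_bodies_def minkowski_comb_def)
  ultimately show ?thesis by (simp add: convex_bodies_def)
qed

definition hypograph :: "(real \<Rightarrow> ennreal) \<Rightarrow> (real \<times> real) set" where
  "hypograph \<phi> = {(r, u). 0 < r \<and> 0 < u \<and> ennreal u < \<phi> r}"

lemma emeasure_lborel_Ioi: "emeasure lborel {0 :: real<..} = \<infinity>"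
proof -
  have "ennreal (real n) \<le> emeasure lborel {0 :: real<..}" for n
  proof -
    have "emeasure lborel {0<..<real n} \<le> emeasure lborel {0 :: real<..}" by (intro emeasure_mono) auto
    then show ?thesis by simp
  qed
  then have "of_nat n \<le> emeasure lborel {0 :: real<..}" for n
    by (simp add: ennreal_of_nat_eq_real_of_nat)
  then show ?thesis using ennreal_Ex_less_of_nat by (metis infinity_ennreal_def leD less_top)
qed

context
  fixes \<phi> :: "real \<Rightarrow> ennreal"
  assumes anti: "\<And>r s. 0 < r \<Longrightarrow> r \<le> s \<Longrightarrow> \<phi> s \<le> \<phi> r"
begin

lemma antitone_measurable: "(\<lambda>r. \<phi> r * indicator {0<..} r) \<in> borel_measurable borel"
proof (rule borel_measurableI_greater)
  fix a
  have "is_interval {r. a < \<phi> r * indicator {0<..} r}"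
    unfolding is_interval_1
  proof (intro ballI allI impI)
    fix r s x assume "r \<in> {r. a < \<phi> r * indicator {0<..} r}" "s \<in> {r. a < \<phi> r * indicator {0<..} r}"
      and x: "r \<le> x \<and> x \<le> s"
    then have "0 < r" "a < \<phi> s" by (auto split: split_indicator_asm)
    moreover from this(1) have "\<phi> s \<le> \<phi> x" using x by (intro anti) auto
    ultimately show "x \<in> {r. a < \<phi> r * indicator {0<..} r}" using x by auto
  qed
  then show "{r \<in> space borel. a < \<phi> r * indicator {0<..} r} \<in> sets borel"
    using real_interval_borel_measurable by simp
qed

lemma hypograph_measurable:
  "hypograph \<phi> \<in> sets borel"
  "{(r, u). 0 < r \<and> 0 < u \<and> ennreal u \<le> \<phi> r} \<in> sets borel"
proof -
  note [measurable] = antitone_measurable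
  have "{p \<in> space (borel \<Otimes>\<^sub>M borel). 0 < fst p \<and> 0 < snd p \<and> ennreal (snd p) < \<phi> (fst p) * indicator {0<..} (fst p)}
    \<in> sets (borel \<Otimes>\<^sub>M borel :: (real \<times> real) measure)" by measurable
  moreover have "{p \<in> space (borel \<Otimes>\<^sub>M borel). 0 < fst p \<and> 0 < snd p \<and> ennreal (snd p) \<le> \<phi> (fst p) * indicator {0<..} (fst p)}
    \<in> sets (borel \<Otimes>\<^sub>M borel :: (real \<times> real) measure)" by measurable
  moreover have "{p \<in> space (borel \<Otimes>\<^sub>M borel). 0 < fst p \<and> 0 < snd p \<and> ennreal (snd p) < \<phi> (fst p) * indicator {0<..} (fst p)} = hypograph \<phi>"
    by (auto simp: hypograph_def space_pair_measure)
  moreover have "{p \<in> space (borel \<Otimes>\<^sub>M borel). 0 < fst p \<and> 0 < snd p \<and> ennreal (snd p) \<le> \<phi> (fst p) * indicator {0<..} (fst p)}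
     = {(r, u). 0 < r \<and> 0 < u \<and> ennreal u \<le> \<phi> r}"
    by (auto simp: space_pair_measure)
  ultimately show "hypograph \<phi> \<in> sets borel"
    "{(r, u). 0 < r \<and> 0 < u \<and> ennreal u \<le> \<phi> r} \<in> sets borel"
    by (simp_all only: borel_prod)
qed

text \<open>The boundary of the region does not contribute to the area. In the application the open region
  provides witnesses for suprema, and the closed one contains the combinations of such points.\<close>
lemma emeasure_hypograph:
  "emeasure lborel (hypograph \<phi>) = (\<integral>\<^sup>+r\<in>{0<..}. \<phi> r \<partial>lborel)"
  "emeasure lborel {(r, u). 0 < r \<and> 0 < u \<and> ennreal u \<le> \<phi> r} = (\<integral>\<^sup>+r\<in>{0<..}. \<phi> r \<partial>lborel)"
proof -
  have lt: "emeasure lborel (Pair r -` hypograph \<phi>) = \<phi> r * indicator {0<..} r" for r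
  proof (cases "\<phi> r")
    case (real y)
    then have "Pair r -` hypograph \<phi> = (if 0 < r then {0<..<y} else {})"
      by (auto simp: hypograph_def ennreal_less_iff)
    then show ?thesis using real by simp
  next
    case top
    then have "Pair r -` hypograph \<phi> = (if 0 < r then {0<..} else {})"
      by (auto simp: hypograph_def)
    then show ?thesis using top by (simp add: emeasure_lborel_Ioi)
  qed
  have le: "emeasure lborel (Pair r -` {(r, u). 0 < r \<and> 0 < u \<and> ennreal u \<le> \<phi> r}) = \<phi> r * indicator {0<..} r" for r
  proof (cases "\<phi> r")
    case (real y)
    then have "Pair r -` {(r, u). 0 < r \<and> 0 < u \<and> ennreal u \<le> \<phi> r} = (if 0 < r then {0<..y} else {})"
      by (auto simp: ennreal_le_iff)
    then show ?thesis using real by simp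
  next
    case top
    then have "Pair r -` {(r, u). 0 < r \<and> 0 < u \<and> ennreal u \<le> \<phi> r} = (if 0 < r then {0<..} else {})"
      by auto
    then show ?thesis using top by (simp add: emeasure_lborel_Ioi)
  qed
  have alt: "emeasure lborel S = (\<integral>\<^sup>+r. emeasure lborel (Pair r -` S) \<partial>lborel)" if "S \<in> sets borel" for S :: "(real \<times> real) set"
  proof -
    have "S \<in> sets (lborel \<Otimes>\<^sub>M lborel)" using that unfolding lborel_prod by simp
    from lborel.emeasure_pair_measure_alt[OF this] show ?thesis by (simp add: lborel_prod)
  qed
  show "emeasure lborel (hypograph \<phi>) = (\<integral>\<^sup>+r\<in>{0<..}. \<phi> r \<partial>lborel)"
    unfolding alt[OF hypograph_measurable(1)] lt ..
  show "emeasure lborel {(r, u). 0 < r \<and> 0 < u \<and> ennreal u \<le> \<phi> r} = (\<integral>\<^sup>+r\<in>{0<..}. \<phi> r \<partial>lborel)"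
    unfolding alt[OF hypograph_measurable(2)] le ..
qed

end

section \<open>Concave functionals of functions\<close>
theorem theorem4p2:
  fixes \<Phi> :: "(real ^ 'n) set \<Rightarrow> ennreal"
    and \<C> :: "(real ^ 'n) set set"
    and f g h :: "real ^ 'n \<Rightarrow> real"
    and \<alpha> \<gamma> :: ereal
    and lam :: real
  assumes lambda: "0 < lam" "lam < 1"
    and gamma: "\<gamma> \<le> 1"
    and alpha: "- \<gamma> \<le> \<alpha>"
    and nonneg: "\<And>x. 0 \<le> f x" "\<And>x. 0 \<le> g x" "\<And>x. 0 \<le> h x"
    and setting:
      "(\<C> = sets borel \<and> (\<forall>k\<in>{f, g, h}. k \<in> borel_measurable borel)) \<or>
       (\<C> = convex_bodies \<and> (\<forall>k\<in>{f, g, h}. semicontinuous k \<and> quasi_concave k))"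
    and empty: "\<Phi> {} = 0"
    and monotone: "mono_on (with_combs lam \<C>) \<Phi>"
    and concave: "concave_functional \<C> \<gamma> lam \<Phi>"
    and ineq: "\<And>x y. 0 < f x * g y \<Longrightarrow>
      power_mean \<alpha> lam (ennreal (f x)) (ennreal (g y)) \<le> ennreal (h ((1 - lam) *\<^sub>R x + lam *\<^sub>R y))"
    and nondegenerate: "0 < mean_exponent \<alpha> \<gamma> \<Longrightarrow>
      (0 < functional_ext \<C> \<Phi> f \<longleftrightarrow> 0 < functional_ext \<C> \<Phi> g)"
  shows "power_mean (mean_exponent \<alpha> \<gamma>) lam (functional_ext \<C> \<Phi> f) (functional_ext \<C> \<Phi> g)
    \<le> functional_ext \<C> \<Phi> h"
proof -
  define v where "v k r = value_on \<C> \<Phi> {x. r \<le> k x}" for k :: "real ^ 'n \<Rightarrow> real" and r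
  define P where "P = hypograph (v f)"
  define Q where "Q = hypograph (v g)"
  define R where "R = {(t, w). 0 < t \<and> 0 < w \<and> ennreal w \<le> v h t}"
  have mono: "mono_on \<C> \<Phi>"
    using monotone by (rule mono_on_subset) (auto simp: with_combs_def)
  have anti: "v k s \<le> v k r" if "0 < r" "r \<le> s" for k r s
    unfolding v_def using that by (intro value_on_mono mono) auto
  have meas: "P \<in> sets borel" "Q \<in> sets borel" "R \<in> sets borel"
    unfolding P_def Q_def R_def by (rule hypograph_measurable; erule (1) anti)+
  have ext: "functional_ext \<C> \<Phi> f = emeasure lborel P" "functional_ext \<C> \<Phi> g = emeasure lborel Q"
    "functional_ext \<C> \<Phi> h = emeasure lborel R"
  proof -
    have "functional_ext \<C> \<Phi> k = (\<integral>\<^sup>+r\<in>{0<..}. v k r \<partial>lborel)" for k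
      by (simp add: functional_ext_def v_def)
    moreover have "emeasure lborel (hypograph (v k)) = (\<integral>\<^sup>+r\<in>{0<..}. v k r \<partial>lborel)"
      "emeasure lborel {(r, u). 0 < r \<and> 0 < u \<and> ennreal u \<le> v k r} = (\<integral>\<^sup>+r\<in>{0<..}. v k r \<partial>lborel)" for k
      by (rule emeasure_hypograph; erule (1) anti)+
    ultimately
    show "functional_ext \<C> \<Phi> f = emeasure lborel P" "functional_ext \<C> \<Phi> g = emeasure lborel Q"
      "functional_ext \<C> \<Phi> h = emeasure lborel R"
      unfolding P_def Q_def R_def by simp_all
  qed
  have down: "(r', u') \<in> hypograph (v k)" if "(r, u) \<in> hypograph (v k)" "0 < r'" "r' \<le> r" "0 < u'" "u' \<le> u" for k r r' u u'
  proof -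
    have "ennreal u' \<le> ennreal u" using that by (intro ennreal_leI)
    also have "\<dots> < v k r" using that by (simp add: hypograph_def)
    also have "v k r \<le> v k r'" using that by (intro anti)
    finally show ?thesis using that by (simp add: hypograph_def)
  qed
  \<comment> \<open>One of the two sides of \<open>\<Phi> K \<le> \<Phi> {t \<le> h}\<close> may lie outside the class: the combination
    for Borel sets, the superlevel set for convex bodies.\<close>
  have target: "{x. t \<le> h x} \<in> \<C> \<or> minkowski_comb lam K0 K1 \<in> \<C>" if "K0 \<in> \<C>" "K1 \<in> \<C>" for t K0 K1
    using setting
  proof
    assume *: "\<C> = sets borel \<and> (\<forall>k\<in>{f, g, h}. k \<in> borel_measurable borel)"
    then have [measurable]: "h \<in> borel_measurable borel" by simp
    have "{x \<in> space borel. t \<le> h x} \<in> sets borel" by measurable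
    then show ?thesis using * by simp
  next
    assume "\<C> = convex_bodies \<and> (\<forall>k\<in>{f, g, h}. semicontinuous k \<and> quasi_concave k)"
    then show ?thesis using minkowski_comb_convex_body that by blast
  qed
  \<comment> \<open>The inequality \<open>\<chi> (M\<^sub>\<alpha>(r, s)) \<ge> M\<^sub>\<gamma>(\<phi> r, \<psi> s)\<close>, in terms of the regions.\<close>
  have comb: "(real_mean \<alpha> lam r s, real_mean \<gamma> lam u w) \<in> R" if ru: "(r, u) \<in> P" and sw: "(s, w) \<in> Q" for r u s w
  proof -
    have pos: "0 < r" "0 < u" "0 < s" "0 < w" using ru sw by (auto simp: P_def Q_def hypograph_def)
    obtain K0 where K0: "K0 \<in> \<C>" "K0 \<subseteq> {x. r \<le> f x}" "ennreal u < \<Phi> K0"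
      using ru value_on_less[of "ennreal u" \<C> \<Phi> "{x. r \<le> f x}"] by (auto simp: P_def hypograph_def v_def)
    obtain K1 where K1: "K1 \<in> \<C>" "K1 \<subseteq> {x. s \<le> g x}" "ennreal w < \<Phi> K1"
      using sw value_on_less[of "ennreal w" \<C> \<Phi> "{x. s \<le> g x}"] by (auto simp: Q_def hypograph_def v_def)
    define t where "t = real_mean \<alpha> lam r s"
    define K where "K = minkowski_comb lam K0 K1"
    have t: "0 < t" unfolding t_def by (intro real_mean_pos lambda pos)
    have sub: "K \<subseteq> {x. t \<le> h x}"
    proof
      fix z assume "z \<in> K"
      then obtain x y where xy: "x \<in> K0" "y \<in> K1" "z = (1 - lam) *\<^sub>R x + lam *\<^sub>R y"
        by (auto simp: K_def minkowski_comb_def)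
      then have le: "r \<le> f x" "s \<le> g y" using K0 K1 by auto
      have "ennreal t = power_mean \<alpha> lam (ennreal r) (ennreal s)"
        unfolding t_def by (rule power_mean_ennreal[OF lambda, symmetric]) (use pos in auto)
      also have "\<dots> \<le> power_mean \<alpha> lam (ennreal (f x)) (ennreal (g y))"
        by (intro power_mean_mono lambda ennreal_leI le)
      also have "\<dots> \<le> ennreal (h z)" unfolding xy(3) using le pos by (intro ineq mult_pos_pos) auto
      finally show "z \<in> {x. t \<le> h x}" using nonneg(3) by simp
    qed
    have "\<Phi> K \<le> v h t"
    proof (cases "K \<in> \<C>")
      case False
      then have "{x. t \<le> h x} \<in> \<C>" using target K0(1) K1(1) K_def by blast
      moreover from this have "{x. t \<le> h x} \<in> with_combs lam \<C>" by (simp add: with_combs_def)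
      moreover have "K \<in> with_combs lam \<C>" using K0 K1 by (auto simp: with_combs_def K_def)
      ultimately show ?thesis using mono_onD[OF monotone] sub
        by (simp add: v_def value_on_def)
    next
      case True
      then show ?thesis unfolding v_def using sub by (rule value_on_upper[OF mono])
    qed
    have "ennreal (real_mean \<gamma> lam u w) = power_mean \<gamma> lam (ennreal u) (ennreal w)"
      by (rule power_mean_ennreal[OF lambda, symmetric]) (use pos in auto)
    also have "\<dots> \<le> power_mean \<gamma> lam (\<Phi> K0) (\<Phi> K1)"
      using K0 K1 by (intro power_mean_mono lambda) auto
    also have "\<dots> \<le> \<Phi> K"
      using concave K0 K1 unfolding concave_functional_def K_def by (meson le_less_trans zero_le)
    also have "\<dots> \<le> v h t" by fact
    finally show ?thesis using t real_mean_pos[OF lambda pos(2,4), of \<gamma>] by (simp add: R_def t_def)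
  qed
  define \<beta> where "\<beta> = mean_exponent \<alpha> \<gamma>"
  have "power_mean \<beta> lam (emeasure lborel P) (emeasure lborel Q) \<le> emeasure lborel R"
  proof (cases "emeasure lborel P = 0 \<or> emeasure lborel Q = 0")
    case True
    \<comment> \<open>\<open>M\<^sub>\<beta>(0, y)\<close> vanishes for \<open>\<beta> \<le> 0\<close> but not for \<open>\<beta> > 0\<close>, where \<open>nondegenerate\<close> excludes \<open>y > 0\<close>.\<close>
    show ?thesis
    proof (cases "\<beta> \<le> 0")
      case False
      then have "emeasure lborel P = 0 \<and> emeasure lborel Q = 0"
        using nondegenerate True unfolding ext \<beta>_def[symmetric] by (auto simp: zero_less_iff_neq_zero)
      then show ?thesis by (simp add: power_mean_zero_zero[OF lambda])
    qed (use True in \<open>simp add: power_mean_zero[OF lambda]\<close>)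
  next
    case False
    show ?thesis
    proof (cases \<gamma>)
      case (real c)
      show ?thesis unfolding \<beta>_def real
      proof (rule planar_brunn_minkowski[OF lambda])
        show "c \<le> 1" "- ereal c \<le> \<alpha>" using gamma alpha real by auto
        show "P \<subseteq> {0<..} \<times> {0<..}" "Q \<subseteq> {0<..} \<times> {0<..}"
          by (auto simp: P_def Q_def hypograph_def)
        show "(r', u) \<in> P" if "(r, u) \<in> P" "0 < r'" "r' \<le> r" for r r' u
          unfolding P_def by (rule down) (use that in \<open>auto simp: P_def hypograph_def\<close>)
        show "(r', u) \<in> Q" if "(r, u) \<in> Q" "0 < r'" "r' \<le> r" for r r' u
          unfolding Q_def by (rule down) (use that in \<open>auto simp: Q_def hypograph_def\<close>)
        show "P \<in> sets borel" by (fact meas(1))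
        show "Q \<in> sets borel" by (fact meas(2))
        show "R \<in> sets borel" by (fact meas(3))
        show "(real_mean \<alpha> lam r s, real_mean (ereal c) lam u w) \<in> R" if "(r, u) \<in> P" "(s, w) \<in> Q" for r u s w
          using comb[OF that] real by simp
        show "0 < emeasure lborel P" "0 < emeasure lborel Q" using False by (simp_all add: zero_less_iff_neq_zero)
      qed
    next
      case PInf
      then show ?thesis using gamma by simp
    next
      case MInf
      have \<alpha>: "\<alpha> = \<infinity>" using alpha MInf by simp
      have \<beta>: "\<beta> = -\<infinity>" by (simp add: \<beta>_def mean_exponent_def MInf)
      have c: "(max r s, min u w) \<in> R" if "(r, u) \<in> P" "(s, w) \<in> Q" for r u s w
        using comb[OF that] by (simp add: MInf \<alpha> real_mean_simps)
      have downR: "(r, u) \<in> R" if "(r', u) \<in> R" "0 < r" "r \<le> r'" for r r' u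
        using that anti[of r r' h] by (auto simp: R_def)
      \<comment> \<open>If every height that occurs in \<open>P\<close> occurs in \<open>Q\<close>, combine two points of equal height to
        see that \<open>P \<subseteq> R\<close>; otherwise every height of \<open>Q\<close> occurs in \<open>P\<close>.\<close>
      have "P \<subseteq> R \<or> Q \<subseteq> R"
      proof (cases "\<forall>(r, u)\<in>P. \<exists>s. (s, u) \<in> Q")
        case True
        have "(r, u) \<in> R" if ru: "(r, u) \<in> P" for r u
        proof -
          obtain s where "(s, u) \<in> Q" using True ru by blast
          from c[OF ru this] have "(max r s, u) \<in> R" by simp
          then show ?thesis by (rule downR) (use ru in \<open>auto simp: P_def hypograph_def\<close>)
        qed
        then show ?thesis by auto
      next
        case False
        then obtain r0 u0 where r0: "(r0, u0) \<in> P" "\<And>s. (s, u0) \<notin> Q" by blast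
        have "(s, w) \<in> R" if sw: "(s, w) \<in> Q" for s w
        proof -
          have "w < u0"
          proof (rule ccontr)
            assume "\<not> w < u0"
            then have "(s, u0) \<in> Q"
              using r0(1) sw unfolding Q_def by (intro down[of s w g s u0]) (auto simp: P_def hypograph_def)
            then show False using r0(2) by simp
          qed
          then have "(r0, w) \<in> P"
            using r0(1) sw unfolding P_def by (intro down[of r0 u0 f r0 w]) (auto simp: Q_def hypograph_def)
          from c[OF this sw] have "(max r0 s, w) \<in> R" by simp
          then show ?thesis by (rule downR) (use sw in \<open>auto simp: Q_def hypograph_def\<close>)
        qed
        then show ?thesis by auto
      qed
      then have "emeasure lborel P \<le> emeasure lborel R \<or> emeasure lborel Q \<le> emeasure lborel R"
        using meas by (auto intro: emeasure_mono)
      then show ?thesis by (auto simp: \<beta> power_mean_def min_le_iff_disj)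
    qed
  qed
  then show ?thesis unfolding ext \<beta>_def .
qed

end
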